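(* Thompson's group $F$ has a subgroup $H$ such that the conjugacy problem in $H$ is undecidable and the membership problem in $H$ is decidable.
   Context: $F$ is the group of all piecewise-linear homeomorphisms of $[0,1]$ with finitely many breakpoints, all of them in $\mathbb Z[\frac12]\cap(0,1)$, and all slopes integer powers of $2$. $F$ is finitely generated (even finitely presented) with decidable word problem; elements of $F$ are given as inputs to algorithms in any of the standard equivalent finite forms (words in a finite generating set, reduced diagrams, or pairs of finite binary trees). For a subgroup $H\le F$: the membership problem in $H$ asks, given an element of $F$, whether it belongs to $H$; the conjugacy problem in $H$ asks, given two elements of $F$ that belong to $H$, whether they are conjugate by an element of $H$. *)

theory Defs
  imports "HOL-Analysis.Analysis" "HOL-Algebra.Bij"
begin

section \<open>Thompson's group \<open>F\<close>\<close>

definition dyadic_rationals :: "real set" where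
  "dyadic_rationals = {of_int m / 2 ^ n | (m :: int) (n :: nat). True}"

text \<open>
  The set \<open>B\<close> may contain points that are not genuine breakpoints; enlarging the set of
  breakpoints by finitely many dyadic points of \<open>(0,1)\<close> does not change the condition.
  Functions are taken to be extensional, i.e. \<open>undefined\<close> outside \<open>[0,1]\<close>, so that equality of
  functions is equality on \<open>[0,1]\<close>.
\<close>

definition thompson_F_set :: "(real \<Rightarrow> real) set" where
  "thompson_F_set = {f \<in> extensional {0..1}.
     (\<exists>g. homeomorphism {0..1} {0..1} f g) \<and>
     (\<exists>B. finite B \<and> B \<subseteq> dyadic_rationals \<inter> {0<..<1} \<and>
        (\<forall>a b. 0 \<le> a \<and> a < b \<and> b \<le> 1 \<and> {a<..<b} \<inter> B = {} \<longrightarrow>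
           (\<exists>k :: int. \<forall>x\<in>{a..b}. f x = f a + 2 powi k * (x - a))))}"

text \<open>
  The product of \<open>f\<close> and \<open>g\<close> is the composition \<open>f \<circ> g\<close> (on \<open>[0,1]\<close>). Using the opposite
  convention would change neither the subgroups nor their conjugacy relations.
\<close>

definition thompson_F :: "(real \<Rightarrow> real) monoid" where
  "thompson_F = (BijGroup {0..1}) \<lparr>carrier := thompson_F_set\<rparr>"

text \<open>The standard two generators \<open>x\<^sub>0\<close>, \<open>x\<^sub>1\<close> of \<open>F\<close> (Cannon--Floyd--Parry's \<open>A\<close> and \<open>B\<close>),
  so that every element of \<open>F\<close> is represented by a word in them and their inverses.\<close>

definition gen0 :: "real \<Rightarrow> real" where
  "gen0 = (\<lambda>t\<in>{0..1}. if t \<le> 1/2 then t / 2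
                       else if t \<le> 3/4 then t - 1/4
                       else 2 * t - 1)"

definition gen1 :: "real \<Rightarrow> real" where
  "gen1 = (\<lambda>t\<in>{0..1}. if t \<le> 1/2 then t
                       else if t \<le> 3/4 then t / 2 + 1/4
                       else if t \<le> 7/8 then t - 1/8
                       else 2 * t - 1)"

datatype letter = X0 | X0_inv | X1 | X1_inv

fun letter_elem :: "letter \<Rightarrow> (real \<Rightarrow> real)" where
  "letter_elem X0 = gen0"
| "letter_elem X0_inv = inv\<^bsub>thompson_F\<^esub> gen0"
| "letter_elem X1 = gen1"
| "letter_elem X1_inv = inv\<^bsub>thompson_F\<^esub> gen1"

fun word_elem :: "letter list \<Rightarrow> (real \<Rightarrow> real)" where
  "word_elem [] = \<one>\<^bsub>thompson_F\<^esub>"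
| "word_elem (l # w) = letter_elem l \<otimes>\<^bsub>thompson_F\<^esub> word_elem w"

section \<open>Algorithms\<close>

text \<open>
  Programs for the partial recursive functions, with their usual evaluation relation:
  \<open>rec_eval r xs y\<close> means that \<open>r\<close> halts on input \<open>xs\<close> with output \<open>y\<close>.
\<close>

datatype recf =
    Zero
  | Succ
  | Proj nat
  | Comp recf "recf list"
  | PrimRec recf recf
  | Mu recf

inductive rec_eval :: "recf \<Rightarrow> nat list \<Rightarrow> nat \<Rightarrow> bool" where
  zero: "rec_eval Zero xs 0"
| succ: "rec_eval Succ [x] (Suc x)"
| proj: "i < length xs \<Longrightarrow> rec_eval (Proj i) xs (xs ! i)"
| comp: "list_all2 (\<lambda>g y. rec_eval g xs y) gs ys \<Longrightarrow> rec_eval f ys z \<Longrightarrow>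
           rec_eval (Comp f gs) xs z"
| primrec_0: "rec_eval f xs y \<Longrightarrow> rec_eval (PrimRec f g) (0 # xs) y"
| primrec_Suc: "rec_eval (PrimRec f g) (n # xs) y \<Longrightarrow> rec_eval g (n # y # xs) z \<Longrightarrow>
           rec_eval (PrimRec f g) (Suc n # xs) z"
| mu: "rec_eval f (n # xs) 0 \<Longrightarrow> \<forall>m<n. \<exists>y>0. rec_eval f (m # xs) y \<Longrightarrow>
           rec_eval (Mu f) xs n"

inductive_cases rec_eval_ZeroE: "rec_eval Zero xs z"
inductive_cases rec_eval_SuccE: "rec_eval Succ xs z"
inductive_cases rec_eval_ProjE: "rec_eval (Proj i) xs z"
inductive_cases rec_eval_CompE: "rec_eval (Comp f gs) xs z"
inductive_cases rec_eval_PrimRec_0E: "rec_eval (PrimRec f g) (0 # xs) z"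
inductive_cases rec_eval_PrimRec_SucE: "rec_eval (PrimRec f g) (Suc n # xs) z"
inductive_cases rec_eval_MuE: "rec_eval (Mu f) xs z"

lemma rec_eval_deterministic:
  "rec_eval r xs y \<Longrightarrow> rec_eval r xs z \<Longrightarrow> y = z"
proof (induction r xs y arbitrary: z rule: rec_eval.induct)
  case (zero xs z)
  then show ?case by (rule rec_eval_ZeroE) simp
next
  case (succ x z)
  then show ?case by (rule rec_eval_SuccE) simp
next
  case (proj i xs z)
  from proj(2) show ?case by (rule rec_eval_ProjE) simp
next
  case (comp xs gs ys f y z)
  from comp.prems obtain ys' where
    ys': "list_all2 (\<lambda>g y. rec_eval g xs y) gs ys'" "rec_eval f ys' z"
    by (blast elim!: rec_eval_CompE)
  have "ys = ys'"
  proof (rule nth_equalityI)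
    show len: "length ys = length ys'"
      using list_all2_lengthD[OF comp.IH(1)] list_all2_lengthD[OF ys'(1)] by simp
    fix i assume i: "i < length ys"
    show "ys ! i = ys' ! i"
      using list_all2_nthD2[OF comp.IH(1) i] list_all2_nthD2[OF ys'(1) i[unfolded len]] by blast
  qed
  then show ?case using comp.IH(2) ys'(2) by blast
next
  case (primrec_0 f xs y g z)
  from primrec_0.prems have "rec_eval f xs z" by (rule rec_eval_PrimRec_0E)
  then show ?case by (rule primrec_0.IH)
next
  case (primrec_Suc f g n xs y y' z)
  from primrec_Suc.prems obtain u where
    u: "rec_eval (PrimRec f g) (n # xs) u" "rec_eval g (n # u # xs) z"
    by (rule rec_eval_PrimRec_SucE)
  have "y = u" using u(1) by (rule primrec_Suc.IH(1))
  then show ?case using primrec_Suc.IH(2) u(2) by blast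
next
  case (mu f n xs z)
  have z: "rec_eval f (z # xs) 0" "\<forall>m<z. \<exists>y>0. rec_eval f (m # xs) y"
    using rec_eval_MuE[OF mu.prems] by auto
  show ?case
  proof (rule linorder_cases[of n z])
    assume "n < z"
    then obtain u where "u > 0" "rec_eval f (n # xs) u" using z(2) by blast
    then show ?thesis using mu.IH(1) by blast
  next
    assume "z < n"
    then obtain u where u: "u > 0" "\<And>v. rec_eval f (z # xs) v \<Longrightarrow> u = v" using mu.IH(2) by blast
    then show ?thesis using u(2)[OF z(1)] by simp
  qed
qed

text \<open>Words as inputs: bijective base-4 numeration, with the first letter least significant.
  Every natural number is the code of exactly one word.\<close>

fun letter_digit :: "letter \<Rightarrow> nat" where
  "letter_digit X0 = 1"
| "letter_digit X0_inv = 2"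
| "letter_digit X1 = 3"
| "letter_digit X1_inv = 4"

fun word_code :: "letter list \<Rightarrow> nat" where
  "word_code [] = 0"
| "word_code (l # w) = letter_digit l + 4 * word_code w"

lemma inj_word_code: "inj word_code"
proof (rule injI)
  fix v w assume "word_code v = word_code w"
  then show "v = w"
  proof (induction v arbitrary: w)
    case Nil
    show ?case
    proof (cases w)
      case (Cons k u)
      then show ?thesis using Nil by (cases k) auto
    qed simp
  next
    case (Cons l v)
    show ?case
    proof (cases w)
      case Nil
      then show ?thesis using Cons.prems by (cases l) auto
    next
      case (Cons k u)
      with Cons.prems have e: "letter_digit l + 4 * word_code v = letter_digit k + 4 * word_code u"
        by simp
      then have "l = k" by (cases l; cases k; simp; presburger)
      with e have "word_code v = word_code u" by simp
      then show ?thesis using Cons.IH \<open>l = k\<close> Cons by simp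
    qed
  qed
qed

section \<open>The decision problems\<close>

definition conjugate_in :: "(real \<Rightarrow> real) set \<Rightarrow> (real \<Rightarrow> real) \<Rightarrow> (real \<Rightarrow> real) \<Rightarrow> bool" where
  "conjugate_in H f g \<longleftrightarrow>
     (\<exists>h\<in>H. g = inv\<^bsub>thompson_F\<^esub> h \<otimes>\<^bsub>thompson_F\<^esub> f \<otimes>\<^bsub>thompson_F\<^esub> h)"

definition membership_decidable :: "(real \<Rightarrow> real) set \<Rightarrow> bool" where
  "membership_decidable H \<longleftrightarrow>
     (\<exists>r. \<forall>w. rec_eval r [word_code w] (if word_elem w \<in> H then 1 else 0))"

text \<open>
  A decision procedure for the conjugacy problem in \<open>H\<close> is required to halt with the correct
  answer only on inputs that represent elements of \<open>H\<close>.
\<close>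

definition conjugacy_decidable :: "(real \<Rightarrow> real) set \<Rightarrow> bool" where
  "conjugacy_decidable H \<longleftrightarrow>
     (\<exists>r. \<forall>v w. word_elem v \<in> H \<longrightarrow> word_elem w \<in> H \<longrightarrow>
        rec_eval r [word_code v, word_code w]
          (if conjugate_in H (word_elem v) (word_elem w) then 1 else 0))"

end

theory Submission
  imports Defs "HOL-Library.Nat_Bijection"
begin

text \<open>
  Let \<open>I\<^sub>n = [2^-(n+2), 2^-(n+1)]\<close> and, for \<open>f \<in> F\<close> preserving all these intervals, let \<open>v\<^sub>n(f)\<close> be the
  sum of the binary logarithms of the slopes of \<open>f\<close> at the two ends of \<open>I\<^sub>n\<close>, taken inside \<open>I\<^sub>n\<close>.
  Each \<open>v\<^sub>n\<close> is a homomorphism. For a copy \<open>f\<close> of \<open>x\<^sub>0\<close> supported in \<open>I\<^sub>n\<close>, everything that commutes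
  with \<open>f\<close> and preserves \<open>I\<^sub>n\<close> acts on \<open>I\<^sub>n\<close> as a power of \<open>f\<close>, and \<open>v\<^sub>n(f) = 0\<close>; hence all conjugators
  from \<open>f\<close> to \<open>k\<inverse>fk\<close> have the same value \<open>v\<^sub>n(k)\<close>, and we can choose \<open>k\<close> with \<open>v\<^sub>n(k) \<noteq> 0\<close>.

  Let \<open>\<tau>(n)\<close> be the positive halting time of the \<open>n\<close>-th machine, or \<open>0\<close> if it does not halt. The subgroup
  \<open>H\<close> consists of the \<open>f\<close> with \<open>v\<^bsub>2n+1\<^esub>(f) = \<tau>(n) v\<^bsub>2n\<^esub>(f)\<close> for all \<open>n\<close>, and \<open>v\<^bsub>2n\<^esub>(f) = 0\<close> whenever
  \<open>\<tau>(n) = 0\<close>. Conjugacy in \<open>H\<close> of the above pair in \<open>I\<^bsub>2n\<^esub>\<close> is equivalent to the halting of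
  machine \<open>n\<close>. Membership is decidable because \<open>v\<^bsub>2n\<^esub>(f) \<noteq> 0\<close> bounds the halting time to be tested
  by \<open>\<bar>v\<^bsub>2n+1\<^esub>(f)\<bar>\<close>, and because a word of length \<open>l\<close> is linear near \<open>0\<close> up to \<open>2^-(l+2)\<close>.
\<close>

section \<open>Computable functions\<close>

text \<open>The source of undecidability is not conjugacy in F: every pair used is conjugate in F by
  an explicit \<open>k\<close>, and only the demand that the conjugator lie in H makes the question
  hard. The obstacle is membership. Allowing v(2n) to be nonzero exactly for halting n would already
  encode halting, but membership would then be equally hard. Coupling v(2n+1) to v(2n) by the factor
  tau(n) makes every element with v(2n) nonzero carry the halting time as a ratio, which a bounded
  search can check. The next interval is available for this because bumps in it commute with both f
  and k. The coupling is a homogeneous linear equation so that it cuts out a subgroup.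

  Both end slopes enter v because conjugators may be multiplied by powers of f, which would change a
  single slope; on powers of f the two logarithms are opposite and cancel. A conjugator with nonzero
  v is obtained from a bump whose support stops before the right end of the interval.\<close>

definition computes :: "recf \<Rightarrow> nat \<Rightarrow> (nat list \<Rightarrow> nat) \<Rightarrow> bool" where
  "computes r k F \<longleftrightarrow> (\<forall>xs. length xs = k \<longrightarrow> rec_eval r xs (F xs))"

definition total_rec :: "nat \<Rightarrow> (nat list \<Rightarrow> nat) \<Rightarrow> bool" where
  "total_rec k F \<longleftrightarrow> (\<exists>r. computes r k F)"

lemma rec_eval_Comp1: "rec_eval g xs y \<Longrightarrow> rec_eval f [y] z \<Longrightarrow> rec_eval (Comp f [g]) xs z"
  by (rule rec_eval.comp[of _ _ "[y]"]) auto

lemma rec_eval_Comp2: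
  "rec_eval g xs y \<Longrightarrow> rec_eval h xs z \<Longrightarrow> rec_eval f [y, z] w \<Longrightarrow> rec_eval (Comp f [g, h]) xs w"
  by (rule rec_eval.comp[of _ _ "[y, z]"]) auto

lemma rec_eval_Proj: "i < length xs \<Longrightarrow> xs ! i = y \<Longrightarrow> rec_eval (Proj i) xs y"
  using rec_eval.proj by blast

lemma total_recI: "(\<And>xs. length xs = k \<Longrightarrow> rec_eval r xs (F xs)) \<Longrightarrow> total_rec k F"
  unfolding total_rec_def computes_def by blast

lemma total_rec_cong:
  "total_rec k F \<Longrightarrow> (\<And>xs. length xs = k \<Longrightarrow> F xs = G xs) \<Longrightarrow> total_rec k G"
  unfolding total_rec_def computes_def by auto

lemma total_rec_nth: "i < k \<Longrightarrow> total_rec k (\<lambda>xs. xs ! i)"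
  by (rule total_recI[of _ "Proj i"]) (simp add: rec_eval.proj)

lemma total_rec_Suc: "total_rec k f \<Longrightarrow> total_rec k (\<lambda>xs. Suc (f xs))"
  unfolding total_rec_def computes_def by (blast intro: rec_eval.succ rec_eval_Comp1)

lemma total_rec_const: "total_rec k (\<lambda>_. c)"
proof (induction c)
  case 0
  show ?case by (rule total_recI[of _ Zero]) (rule rec_eval.zero)
qed (rule total_rec_Suc)

lemma total_rec_comp1:
  "total_rec 1 (\<lambda>xs. F (xs ! 0)) \<Longrightarrow> total_rec k f \<Longrightarrow> total_rec k (\<lambda>xs. F (f xs))"
  unfolding total_rec_def computes_def
proof (elim exE)
  fix r s
  assume r: "\<forall>xs. length xs = 1 \<longrightarrow> rec_eval r xs (F (xs ! 0))"
    and s: "\<forall>xs. length xs = k \<longrightarrow> rec_eval s xs (f xs)"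
  have "rec_eval (Comp r [s]) xs (F (f xs))" if "length xs = k" for xs
    using s that r[rule_format, of "[f xs]"] by (auto intro: rec_eval_Comp1)
  then show "\<exists>r. \<forall>xs. length xs = k \<longrightarrow> rec_eval r xs (F (f xs))" by blast
qed

lemma total_rec_comp2:
  "total_rec 2 (\<lambda>xs. F (xs ! 0) (xs ! 1)) \<Longrightarrow> total_rec k f \<Longrightarrow> total_rec k g \<Longrightarrow>
   total_rec k (\<lambda>xs. F (f xs) (g xs))"
  unfolding total_rec_def computes_def
proof (elim exE)
  fix r s t
  assume r: "\<forall>xs. length xs = 2 \<longrightarrow> rec_eval r xs (F (xs ! 0) (xs ! 1))"
    and s: "\<forall>xs. length xs = k \<longrightarrow> rec_eval s xs (f xs)"
    and t: "\<forall>xs. length xs = k \<longrightarrow> rec_eval t xs (g xs)"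
  have "rec_eval (Comp r [s, t]) xs (F (f xs) (g xs))" if "length xs = k" for xs
    using s t that r[rule_format, of "[f xs, g xs]"] by (auto intro: rec_eval_Comp2)
  then show "\<exists>r. \<forall>xs. length xs = k \<longrightarrow> rec_eval r xs (F (f xs) (g xs))" by blast
qed

lemma rec_eval_PrimRec:
  assumes "rec_eval f xs a"
    and "\<And>i y. rec_eval g (i # y # xs) (G i y)"
  shows "rec_eval (PrimRec f g) (n # xs) (rec_nat a G n)"
  by (induction n) (auto intro: rec_eval.primrec_0 rec_eval.primrec_Suc assms)

lemma total_rec_primrec:
  assumes "total_rec k f" "total_rec (Suc (Suc k)) (\<lambda>xs. G (xs ! 0) (xs ! 1) (drop 2 xs))"
    "total_rec k n"
  shows "total_rec k (\<lambda>xs. rec_nat (f xs) (\<lambda>i y. G i y xs) (n xs))"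
proof -
  obtain rf rg rn where
    rf: "\<And>xs. length xs = k \<Longrightarrow> rec_eval rf xs (f xs)" and
    rg: "\<And>xs. length xs = Suc (Suc k) \<Longrightarrow> rec_eval rg xs (G (xs ! 0) (xs ! 1) (drop 2 xs))" and
    rn: "\<And>xs. length xs = k \<Longrightarrow> rec_eval rn xs (n xs)"
    using assms unfolding total_rec_def computes_def by blast
  \<comment> \<open>\<open>PrimRec\<close> recurses on its first argument, so the bound is put in
    front and the projections copy the parameters behind it.\<close>
  have "rec_eval (Comp (PrimRec rf rg) (rn # map Proj [0..<k])) xs
      (rec_nat (f xs) (\<lambda>i y. G i y xs) (n xs))" if l: "length xs = k" for xs
  proof (rule rec_eval.comp[of _ _ "n xs # xs"])
    show "list_all2 (\<lambda>g y. rec_eval g xs y) (rn # map Proj [0..<k]) (n xs # xs)"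
      using l by (auto intro: rn intro!: rec_eval_Proj simp: list_all2_conv_all_nth nth_Cons split: nat.split)
    show "rec_eval (PrimRec rf rg) (n xs # xs) (rec_nat (f xs) (\<lambda>i y. G i y xs) (n xs))"
    proof (rule rec_eval_PrimRec)
      show "rec_eval rg (i # y # xs) (G i y xs)" for i y
        using rg[of "i # y # xs"] l by simp
    qed (rule rf[OF l])
  qed
  then show ?thesis unfolding total_rec_def computes_def by blast
qed

text \<open>The second hypothesis makes the unbounded search succeed on every input, so minimization
  stays within total functions. Its purpose is to invert the pairing function.\<close>

lemma total_rec_Least:
  assumes "total_rec (Suc k) (\<lambda>xs. F (hd xs) (tl xs))"
    and "\<And>xs. length xs = k \<Longrightarrow> \<exists>n. F n xs = 0"
  shows "total_rec k (\<lambda>xs. LEAST n. F n xs = 0)"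
proof -
  obtain r where r: "\<And>xs. length xs = Suc k \<Longrightarrow> rec_eval r xs (F (hd xs) (tl xs))"
    using assms(1) unfolding total_rec_def computes_def by blast
  have r': "rec_eval r (n # xs) (F n xs)" if "length xs = k" for n xs
    using r[of "n # xs"] that by simp
  have "rec_eval (Mu r) xs (LEAST n. F n xs = 0)" if l: "length xs = k" for xs
  proof (rule rec_eval.mu)
    show "rec_eval r ((LEAST n. F n xs = 0) # xs) 0"
      using r'[OF l, of "LEAST n. F n xs = 0"] LeastI_ex[OF assms(2)[OF l]] by simp
    show "\<forall>m<(LEAST n. F n xs = 0). \<exists>y>0. rec_eval r (m # xs) y"
      using r'[OF l] not_less_Least[of _ "\<lambda>n. F n xs = 0"] by fastforce
  qed
  then show ?thesis unfolding total_rec_def computes_def by blast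
qed

section \<open>Arithmetic and the Cantor pairing function\<close>

lemma total_rec_add: "total_rec 2 (\<lambda>xs. xs ! 0 + xs ! 1)"
proof -
  have "total_rec 2 (\<lambda>xs. rec_nat (xs ! 0) (\<lambda>i y. Suc y) (xs ! 1))"
    by (rule total_rec_primrec) (auto intro!: total_rec_nth total_rec_Suc)
  moreover have "rec_nat a (\<lambda>i y. Suc y) b = a + b" for a b :: nat
    by (induction b) auto
  ultimately show ?thesis by simp
qed

lemma total_rec_pred: "total_rec 1 (\<lambda>xs. xs ! 0 - 1)"
proof -
  have "total_rec 1 (\<lambda>xs. rec_nat 0 (\<lambda>i y. i) (xs ! 0))"
    by (rule total_rec_primrec) (auto intro!: total_rec_nth total_rec_const)
  moreover have "rec_nat 0 (\<lambda>i y. i) b = b - 1" for b :: nat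
    by (cases b) auto
  ultimately show ?thesis by simp
qed

lemma total_rec_diff: "total_rec 2 (\<lambda>xs. xs ! 0 - xs ! 1)"
proof -
  have "total_rec 2 (\<lambda>xs. rec_nat (xs ! 0) (\<lambda>i y. y - 1) (xs ! 1))"
    by (rule total_rec_primrec)
      (auto simp del: One_nat_def intro!: total_rec_nth total_rec_comp1[OF total_rec_pred])
  moreover have "rec_nat a (\<lambda>i y. y - 1) b = a - b" for a b :: nat
    by (induction b) auto
  ultimately show ?thesis by simp
qed

lemma total_rec_triangle: "total_rec 1 (\<lambda>xs. triangle (xs ! 0))"
proof -
  have "total_rec 1 (\<lambda>xs. rec_nat 0 (\<lambda>i y. y + Suc i) (xs ! 0))"
    by (rule total_rec_primrec)
      (auto intro!: total_rec_nth total_rec_const total_rec_comp2[OF total_rec_add] total_rec_Suc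
        simp del: add_Suc_right)
  moreover have "rec_nat 0 (\<lambda>i y. y + Suc i) b = triangle b" for b :: nat
    by (induction b) auto
  ultimately show ?thesis by simp
qed

lemma total_rec_prod_encode: "total_rec 2 (\<lambda>xs. prod_encode (xs ! 0, xs ! 1))"
proof -
  have "total_rec 2 (\<lambda>xs. triangle (xs ! 0 + xs ! 1) + xs ! 0)"
    by (intro total_rec_comp2[OF total_rec_add] total_rec_comp1[OF total_rec_triangle] total_rec_nth)
      auto
  then show ?thesis by (simp add: prod_encode_def)
qed

text \<open>In Cantor's enumeration \<open>z = triangle (m + n) + m\<close>, so the diagonal
  \<open>m + n\<close> is the least \<open>k\<close> with \<open>z < triangle (Suc k)\<close>. The
  inequality is phrased as the vanishing of a truncated difference, the form that minimization
  accepts.\<close>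

lemma prod_decode_Least:
  fixes z :: nat
  defines "k \<equiv> LEAST k. Suc z - triangle (Suc k) = 0"
  shows "prod_decode z = (z - triangle k, k - (z - triangle k))"
proof -
  obtain m n where mn: "prod_decode z = (m, n)" by fastforce
  then have z: "z = triangle (m + n) + m"
    using prod_decode_inverse[of z] by (simp add: prod_encode_def)
  have tri_mono: "triangle i \<le> triangle j" if "i \<le> j" for i j
    using that by (induction rule: dec_induct) auto
  have "k = m + n"
    unfolding k_def
  proof (rule Least_equality)
    show "Suc z - triangle (Suc (m + n)) = 0" using z by simp
    fix y assume y: "Suc z - triangle (Suc y) = 0"
    show "m + n \<le> y"
    proof (rule ccontr)
      assume "\<not> m + n \<le> y"
      then have "triangle (Suc y) \<le> triangle (m + n)" by (intro tri_mono) simp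
      then show False using y z by simp
    qed
  qed
  then show ?thesis using mn z by simp
qed

lemma total_rec_prod_decode_root: "total_rec 1 (\<lambda>xs. LEAST k. Suc (xs ! 0) - triangle (Suc k) = 0)"
proof (rule total_rec_Least)
  have "total_rec (Suc 1) (\<lambda>xs. Suc (xs ! 1) - triangle (Suc (xs ! 0)))"
    by (intro total_rec_comp2[OF total_rec_diff] total_rec_comp1[OF total_rec_triangle]
        total_rec_Suc total_rec_nth) auto
  then show "total_rec (Suc 1) (\<lambda>xs. Suc (tl xs ! 0) - triangle (Suc (hd xs)))"
    by (rule total_rec_cong) (auto simp: length_Suc_conv)
  show "\<exists>n. Suc (xs ! 0) - triangle (Suc n) = 0" for xs
    by (rule exI[of _ "xs ! 0"]) simp
qed

lemma total_rec_fst_prod_decode: "total_rec 1 (\<lambda>xs. fst (prod_decode (xs ! 0)))"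
  unfolding prod_decode_Least fst_conv
  by (intro total_rec_comp2[OF total_rec_diff] total_rec_comp1[OF total_rec_triangle]
        total_rec_prod_decode_root total_rec_nth) auto

lemma total_rec_snd_prod_decode: "total_rec 1 (\<lambda>xs. snd (prod_decode (xs ! 0)))"
  unfolding prod_decode_Least snd_conv
  by (intro total_rec_comp2[OF total_rec_diff] total_rec_comp1[OF total_rec_triangle]
        total_rec_prod_decode_root total_rec_nth) auto

section \<open>Computability of functions between encoded types\<close>

class enc =
  fixes enc :: "'a \<Rightarrow> nat"
  assumes enc_eq_iff [simp]: "enc x = enc y \<longleftrightarrow> x = y"

instantiation nat :: enc
begin
definition enc_nat_def [simp]: "enc (n :: nat) = n"
instance by standard simp
end

instantiation bool :: enc
begin
definition enc_bool_def: "enc (b :: bool) = (of_bool b :: nat)"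
instance by standard (auto simp: enc_bool_def)
end

instantiation prod :: (enc, enc) enc
begin
definition enc_prod_def: "enc p = prod_encode (enc (fst p), enc (snd p))"
instance by standard (auto simp: enc_prod_def prod_eq_iff)
end

instantiation list :: (enc) enc
begin
definition enc_list_def: "enc l = list_encode (map enc l)"
instance
proof
  fix x y :: "'a list"
  have "inj (enc :: 'a \<Rightarrow> nat)" by (rule injI) simp
  then show "enc x = enc y \<longleftrightarrow> x = y"
    by (simp add: enc_list_def list_encode_eq)
qed
end

lemma enc_Pair: "enc (a, b) = prod_encode (enc a, enc b)"
  by (simp add: enc_prod_def)

lemma enc_Nil: "enc [] = 0"
  by (simp add: enc_list_def)

lemma enc_Cons: "enc (x # xs) = Suc (prod_encode (enc x, enc xs))"
  by (simp add: enc_list_def)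

text \<open>Programs are unary here; several arguments are passed as one coded pair, so that the
  closure rules have the same shape for all types.\<close>

definition computable :: "('a::enc \<Rightarrow> 'b::enc) \<Rightarrow> bool" where
  "computable f \<longleftrightarrow> (\<exists>r. \<forall>x. rec_eval r [enc x] (enc (f x)))"

named_theorems computable_intros

lemma computable_total_rec:
  assumes "total_rec 1 (\<lambda>xs. F (xs ! 0))" "\<And>x. enc (f x) = F (enc x)"
  shows "computable f"
proof -
  obtain r where "\<And>xs. length xs = 1 \<Longrightarrow> rec_eval r xs (F (xs ! 0))"
    using assms(1) unfolding total_rec_def computes_def by blast
  from this[of "[enc x]" for x] have "rec_eval r [enc x] (enc (f x))" for x
    using assms(2)[of x] by simp
  then show ?thesis unfolding computable_def by blast
qed

lemma computable_comp: "computable g \<Longrightarrow> computable f \<Longrightarrow> computable (\<lambda>x. g (f x))"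
  unfolding computable_def by (blast intro: rec_eval_Comp1)

lemma computable_const [computable_intros]: "computable (\<lambda>_. c)"
  by (rule computable_total_rec[of "\<lambda>_. enc c"]) (auto intro: total_rec_const)

lemma computable_same_code: "(\<And>x. enc (f x) = enc x) \<Longrightarrow> computable f"
  by (rule computable_total_rec[of "\<lambda>x. x"]) (auto intro: total_rec_nth)

lemma computable_id [computable_intros]: "computable (\<lambda>x. x)"
  by (rule computable_same_code) simp

lemma computable_Suc [computable_intros]: "computable f \<Longrightarrow> computable (\<lambda>x. Suc (f x))"
  by (rule computable_comp[of Suc], rule computable_total_rec[of Suc])
    (auto intro: total_rec_Suc total_rec_nth)

lemma computable_Pair [computable_intros]:
  assumes "computable f" "computable g"
  shows "computable (\<lambda>x. (f x, g x))"
proof -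
  obtain rf rg rp where rf: "\<And>x. rec_eval rf [enc x] (enc (f x))"
    and rg: "\<And>x. rec_eval rg [enc x] (enc (g x))"
    and rp: "\<And>xs. length xs = 2 \<Longrightarrow> rec_eval rp xs (prod_encode (xs ! 0, xs ! 1))"
    using assms total_rec_prod_encode unfolding computable_def total_rec_def computes_def by blast
  have "rec_eval (Comp rp [rf, rg]) [enc x] (enc (f x, g x))" for x
    using rf[of x] rg[of x] rp[of "[enc (f x), enc (g x)]"]
    by (auto simp: enc_Pair intro: rec_eval_Comp2)
  then show ?thesis unfolding computable_def by blast
qed

lemma computable_fst [computable_intros]: "computable f \<Longrightarrow> computable (\<lambda>x. fst (f x))"
  by (rule computable_comp[of fst], rule computable_total_rec[OF total_rec_fst_prod_decode])
    (auto simp: enc_prod_def)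

lemma computable_snd [computable_intros]: "computable f \<Longrightarrow> computable (\<lambda>x. snd (f x))"
  by (rule computable_comp[of snd], rule computable_total_rec[OF total_rec_snd_prod_decode])
    (auto simp: enc_prod_def)

lemma computable_comp2:
  assumes "computable (\<lambda>p. F (fst p) (snd p))" "computable f" "computable g"
  shows "computable (\<lambda>x. F (f x) (g x))"
  using computable_comp[OF assms(1) computable_Pair[OF assms(2,3)]] by simp

lemma computable_rec_nat [computable_intros]:
  assumes "computable f" "computable (\<lambda>p. g (fst (fst p)) (snd (fst p)) (snd p))" "computable n"
  shows "computable (\<lambda>x. rec_nat (f x) (\<lambda>i y. g i y x) (n x))"
proof -
  obtain rf rg rn rp where rf: "\<And>x. rec_eval rf [enc x] (enc (f x))"
    and rg: "\<And>p. rec_eval rg [enc p] (enc (g (fst (fst p)) (snd (fst p)) (snd p)))"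
    and rn: "\<And>x. rec_eval rn [enc x] (enc (n x))"
    and rp: "\<And>xs. length xs = 2 \<Longrightarrow> rec_eval rp xs (prod_encode (xs ! 0, xs ! 1))"
    using assms total_rec_prod_encode unfolding computable_def total_rec_def computes_def by blast
  \<comment> \<open>\<open>rg\<close> expects the single coded argument \<open>((i, y), x)\<close>,
    whereas \<open>PrimRec\<close> supplies three separate ones; \<open>G\<close> does the
    repacking.\<close>
  define G where "G = Comp rg [Comp rp [Comp rp [Proj 0, Proj 1], Proj 2]]"
  have G: "rec_eval G [i, enc y, enc x] (enc (g i y x))" for i y x
  proof -
    have "rec_eval (Comp rp [Proj 0, Proj 1]) [i, enc y, enc x] (enc (i, y))"
      using rp[of "[i, enc y]"]
      by (auto simp: enc_Pair intro!: rec_eval_Comp2[where y = i and z = "enc y"] rec_eval_Proj)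
    then have "rec_eval (Comp rp [Comp rp [Proj 0, Proj 1], Proj 2]) [i, enc y, enc x]
        (enc ((i, y), x))"
      using rp[of "[enc (i, y), enc x]"]
      by - (rule rec_eval_Comp2[where y = "enc (i, y)" and z = "enc x"],
        auto simp: enc_Pair intro!: rec_eval_Proj)
    then show ?thesis
      unfolding G_def using rg[of "((i, y), x)"] by (auto intro: rec_eval_Comp1)
  qed
  have "rec_eval (PrimRec rf G) [k, enc x] (enc (rec_nat (f x) (\<lambda>i y. g i y x) k))" for k x
    by (induction k) (auto intro: rec_eval.primrec_0 rec_eval.primrec_Suc G rf)
  then have "rec_eval (Comp (PrimRec rf G) [rn, Proj 0]) [enc x]
      (enc (rec_nat (f x) (\<lambda>i y. g i y x) (n x)))" for x
    using rn[of x] by (auto intro!: rec_eval_Comp2[where y = "n x" and z = "enc x"] rec_eval_Proj)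
  then show ?thesis unfolding computable_def by blast
qed

text \<open>A case distinction is a recursion of length \<open>0\<close> or \<open>1\<close>,
  bounded by the code of the truth value.\<close>

lemma computable_If [computable_intros]:
  assumes "computable b" "computable f" "computable g"
  shows "computable (\<lambda>x. if b x then f x else g x)"
proof -
  have "computable (of_bool :: bool \<Rightarrow> nat)"
    by (rule computable_same_code) (simp add: enc_bool_def)
  then have "computable (\<lambda>x. of_bool (b x) :: nat)"
    using assms(1) by (rule computable_comp)
  then have "computable (\<lambda>x. rec_nat (g x) (\<lambda>_ _. f x) (of_bool (b x)))"
    using assms(3) by (intro computable_rec_nat computable_comp[OF assms(2)] computable_intros)
  moreover have "rec_nat (g x) (\<lambda>_ _. f x) (of_bool (b x)) = (if b x then f x else g x)" for x
    by auto
  ultimately show ?thesis by simp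
qed

lemma computable_Not [computable_intros]:
  assumes "computable P"
  shows "computable (\<lambda>x. \<not> P x)"
proof -
  have "(\<lambda>x. \<not> P x) = (\<lambda>x. if P x then False else True)" by auto
  then show ?thesis by (simp only:) (intro computable_If computable_const assms)
qed

lemma computable_conj [computable_intros]:
  assumes "computable P" "computable Q"
  shows "computable (\<lambda>x. P x \<and> Q x)"
proof -
  have "(\<lambda>x. P x \<and> Q x) = (\<lambda>x. if P x then Q x else False)" by auto
  then show ?thesis by (simp only:) (intro computable_If computable_const assms)
qed

lemma computable_disj [computable_intros]:
  assumes "computable P" "computable Q"
  shows "computable (\<lambda>x. P x \<or> Q x)"
proof -
  have "(\<lambda>x. P x \<or> Q x) = (\<lambda>x. if P x then True else Q x)" by auto
  then show ?thesis by (simp only:) (intro computable_If computable_const assms)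
qed

lemma computable_add [computable_intros]:
  assumes "computable f" "computable g"
  shows "computable (\<lambda>x. f x + g x :: nat)"
proof -
  have "computable (\<lambda>x. rec_nat (f x) (\<lambda>i y. Suc y) (g x))"
    by (intro computable_rec_nat computable_intros assms)
  moreover have "rec_nat a (\<lambda>i y. Suc y) b = a + b" for a b :: nat
    by (induction b) auto
  ultimately show ?thesis by simp
qed

lemma computable_mult [computable_intros]:
  assumes "computable f" "computable g"
  shows "computable (\<lambda>x. f x * g x :: nat)"
proof -
  have "computable (\<lambda>x. rec_nat 0 (\<lambda>i y. y + f x) (g x))"
    by (intro computable_rec_nat computable_add computable_comp[OF assms(1)] computable_intros assms)
  moreover have "rec_nat 0 (\<lambda>i y. y + a) b = a * b" for a b :: nat
    by (induction b) auto
  ultimately show ?thesis by simp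
qed

lemma computable_power [computable_intros]:
  assumes "computable f" "computable g"
  shows "computable (\<lambda>x. f x ^ g x :: nat)"
proof -
  have "computable (\<lambda>x. rec_nat 1 (\<lambda>i y. y * f x) (g x))"
    by (intro computable_rec_nat computable_mult computable_comp[OF assms(1)] computable_intros assms)
  moreover have "rec_nat 1 (\<lambda>i y. y * a) b = a ^ b" for a b :: nat
    by (induction b) auto
  ultimately show ?thesis by simp
qed

lemma computable_pred [computable_intros]:
  assumes "computable f"
  shows "computable (\<lambda>x. f x - 1 :: nat)"
proof -
  have "computable (\<lambda>x. rec_nat 0 (\<lambda>i y. i) (f x))"
    by (intro computable_rec_nat computable_intros assms)
  moreover have "rec_nat 0 (\<lambda>i y. i) b = b - 1" for b :: nat
    by (cases b) auto
  ultimately show ?thesis by simp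
qed

lemma computable_diff [computable_intros]:
  assumes "computable f" "computable g"
  shows "computable (\<lambda>x. f x - g x :: nat)"
proof -
  have "computable (\<lambda>x. rec_nat (f x) (\<lambda>i y. y - 1) (g x))"
    by (intro computable_rec_nat computable_pred computable_intros assms)
  moreover have "rec_nat a (\<lambda>i y. y - 1) b = a - b" for a b :: nat
    by (induction b) auto
  ultimately show ?thesis by simp
qed

lemma computable_eq_0: "computable f \<Longrightarrow> computable (\<lambda>x. f x = (0::nat))"
proof -
  assume "computable f"
  then have "computable (\<lambda>x. rec_nat True (\<lambda>i y. False) (f x))"
    by (intro computable_rec_nat computable_intros)
  moreover have "rec_nat True (\<lambda>i y. False) b = (b = 0)" for b :: nat
    by (cases b) auto
  ultimately show ?thesis by simp
qed

lemma computable_le [computable_intros]: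
  "computable f \<Longrightarrow> computable g \<Longrightarrow> computable (\<lambda>x. f x \<le> (g x :: nat))"
  using computable_eq_0[OF computable_diff, of f g] by simp

lemma computable_less [computable_intros]:
  "computable f \<Longrightarrow> computable g \<Longrightarrow> computable (\<lambda>x. f x < (g x :: nat))"
  using computable_Not[OF computable_le, of g f] by (simp add: not_le)

text \<open>Since \<open>enc\<close> is injective, equality on any encoded type reduces to two
  comparisons of numbers.\<close>

lemma computable_eq [computable_intros]:
  assumes "computable f" "computable g"
  shows "computable (\<lambda>x. f x = g x)"
proof -
  have e: "computable (\<lambda>x. enc (h x))" if "computable h" for h :: "'a \<Rightarrow> 'b"
    by (rule computable_comp[OF computable_same_code that]) simp
  have "computable (\<lambda>x. enc (f x) \<le> enc (g x) \<and> enc (g x) \<le> enc (f x))"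
    by (intro computable_intros e assms)
  then show ?thesis by (simp add: eq_iff[symmetric])
qed

lemma computable_All_less [computable_intros]:
  fixes P :: "nat \<Rightarrow> 'a::enc \<Rightarrow> bool"
  assumes "computable (\<lambda>p. P (fst p) (snd p))" "computable n"
  shows "computable (\<lambda>x. \<forall>i<n x. P i x)"
proof -
  have "computable (\<lambda>x. rec_nat True (\<lambda>i b. b \<and> P i x) (n x))"
    by (intro computable_rec_nat computable_comp2[OF assms(1)] computable_intros assms)
  moreover have "rec_nat True (\<lambda>i b. b \<and> P i x) k = (\<forall>i<k. P i x)" for k x
    by (induction k) (auto simp: less_Suc_eq)
  ultimately show ?thesis by simp
qed

lemma computable_Ex_less [computable_intros]:
  fixes P :: "nat \<Rightarrow> 'a::enc \<Rightarrow> bool"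
  assumes "computable (\<lambda>p. P (fst p) (snd p))" "computable n"
  shows "computable (\<lambda>x. \<exists>i<n x. P i x)"
  using computable_Not[OF computable_All_less[OF computable_Not, of P n]] assms by simp

lemma computable_Cons [computable_intros]:
  assumes "computable f" "computable g"
  shows "computable (\<lambda>x. f x # g x)"
proof -
  have "computable (\<lambda>p. fst p # snd p)"
    by (rule computable_total_rec[of Suc])
      (auto simp: enc_Cons enc_prod_def intro: total_rec_Suc total_rec_nth)
  from computable_comp2[OF this assms] show ?thesis .
qed

lemma computable_prod_decode [computable_intros]:
  "computable f \<Longrightarrow> computable (\<lambda>x. prod_decode (f x))"
  by (rule computable_comp[OF computable_same_code]) (simp add: enc_prod_def)

lemma computable_list_decode [computable_intros]:
  "computable f \<Longrightarrow> computable (\<lambda>x. list_decode (f x))"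
  by (rule computable_comp[OF computable_same_code])
    (simp add: enc_list_def enc_nat_def[abs_def])

lemma computable_nat_code:
  fixes f :: "'a::enc \<Rightarrow> 'b::enc"
  assumes "computable F" "\<And>x. enc (f x) = F (enc x)"
  shows "computable f"
proof -
  obtain r where "\<And>n. rec_eval r [n] (F n)"
    using assms(1) unfolding computable_def by auto
  then show ?thesis unfolding computable_def using assms(2) by metis
qed

lemma computable_hd [computable_intros]:
  fixes f :: "'a::enc \<Rightarrow> 'b::enc list"
  assumes "computable f"
  shows "computable (\<lambda>x. hd (f x))"
proof (rule computable_comp[OF _ assms], rule computable_nat_code)
  \<comment> \<open>The value \<open>hd []\<close> is unspecified but fixed, so its code can be
    built into the program as a constant.\<close>
  show "computable (\<lambda>n. if n = 0 then enc (hd [] :: 'b) else fst (prod_decode (n - 1)))"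
    by (intro computable_intros)
  show "enc (hd x) = (if enc x = 0 then enc (hd [] :: 'b) else fst (prod_decode (enc x - 1)))"
    for x :: "'b list"
    by (cases x) (auto simp: enc_Nil enc_Cons)
qed

lemma computable_tl [computable_intros]:
  fixes f :: "'a::enc \<Rightarrow> 'b::enc list"
  assumes "computable f"
  shows "computable (\<lambda>x. tl (f x))"
proof (rule computable_comp[OF _ assms], rule computable_nat_code)
  show "computable (\<lambda>n. snd (prod_decode (n - 1)))"
    by (intro computable_intros)
  show "enc (tl x) = snd (prod_decode (enc x - 1))" for x :: "'b list"
  proof (cases x)
    case Nil
    \<comment> \<open>The code of \<open>[]\<close> is \<open>0\<close>, its truncated predecessor
      is again \<open>0\<close>, and this decodes to \<open>(0, 0)\<close>; the formula therefore
      also gives \<open>tl [] = []\<close>.\<close>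
    have "prod_encode (0, 0) = 0" by (simp add: prod_encode_def)
    then have "prod_decode 0 = (0, 0)" by (metis prod_encode_inverse)
    then show ?thesis using Nil by (simp add: enc_Nil)
  qed (auto simp: enc_Cons)
qed

text \<open>A traversal of a list needs an iteration bound before \<open>length\<close> is known to
  be computable; the code itself is one.\<close>

lemma length_le_enc: "length l \<le> enc l"
proof (induction l)
  case (Cons a l)
  then show ?case using le_prod_encode_2[of "enc l" "enc a"] by (simp add: enc_Cons)
qed simp

lemma computable_funpow:
  fixes F :: "'b::enc \<Rightarrow> 'a::enc \<Rightarrow> 'b"
  assumes "computable (\<lambda>p. F (fst p) (snd p))" "computable f" "computable n"
  shows "computable (\<lambda>x. ((\<lambda>y. F y x) ^^ n x) (f x))"
proof -
  have "computable (\<lambda>x. rec_nat (f x) (\<lambda>i y. F y x) (n x))"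
    by (intro computable_rec_nat computable_comp2[OF assms(1)] computable_intros assms)
  moreover have "rec_nat (f x) (\<lambda>i y. F y x) k = ((\<lambda>y. F y x) ^^ k) (f x)" for k x
    by (induction k) auto
  ultimately show ?thesis by simp
qed

lemma computable_foldl [computable_intros]:
  fixes F :: "'b::enc \<Rightarrow> 'c::enc \<Rightarrow> 'a::enc \<Rightarrow> 'b"
  assumes "computable (\<lambda>p. F (fst (fst p)) (snd (fst p)) (snd p))" "computable a" "computable l"
  shows "computable (\<lambda>x. foldl (\<lambda>y e. F y e x) (a x) (l x))"
proof -
  \<comment> \<open>The state consists of the accumulator and the unread part of the list. An empty
    unread part is a fixed point, so surplus iterations are harmless and \<open>enc (l x)\<close> of
    them suffice.\<close>
  define step where "step = (\<lambda>s x. if snd s = [] then s else (F (fst s) (hd (snd s)) x, tl (snd s)))"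
  have F': "computable (\<lambda>y. F (u y) (v y) (w y))"
    if "computable u" "computable v" "computable w" for u v w
    using computable_comp[OF assms(1) computable_Pair[OF computable_Pair[OF that(1,2)] that(3)]]
    by simp
  have "computable (\<lambda>p. step (fst p) (snd p))"
    unfolding step_def by (intro computable_intros F')
  then have c: "computable (\<lambda>x. fst (((\<lambda>s. step s x) ^^ (enc (l x))) (a x, l x)))"
    by (intro computable_fst computable_funpow computable_Pair assms
        computable_comp[OF computable_same_code, of enc]) auto
  have "fst (((\<lambda>s. step s x) ^^ k) (b, m)) = foldl (\<lambda>y e. F y e x) b m"
    if "length m \<le> k" for k b m x
    using that
  proof (induction k arbitrary: b m)
    case (Suc k)
    have "((\<lambda>s. step s x) ^^ k) s' = s'" if "snd s' = []" for s'
      by (induction k) (auto simp: step_def that)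
    then show ?case
      using Suc by (cases m) (simp_all add: funpow_Suc_right step_def del: funpow.simps)
  qed simp
  from this[OF length_le_enc] show ?thesis using c by (simp only:)
qed

lemma computable_length [computable_intros]:
  "computable l \<Longrightarrow> computable (\<lambda>x. length (l x))"
proof -
  assume "computable l"
  then have "computable (\<lambda>x. foldl (\<lambda>y e. Suc y) 0 (l x))"
    by (intro computable_intros)
  moreover have "foldl (\<lambda>y e. Suc y) k m = k + length m" for k :: nat and m :: "'b list"
    by (induction m arbitrary: k) auto
  ultimately show ?thesis by simp
qed

lemma computable_Bex_set [computable_intros]:
  assumes "computable (\<lambda>p. P (fst p) (snd p))" "computable l"
  shows "computable (\<lambda>x. \<exists>e\<in>set (l x). P e x)"
proof -
  have "computable (\<lambda>x. foldl (\<lambda>y e. y \<or> P e x) False (l x))"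
    by (intro computable_foldl computable_comp2[OF assms(1)] computable_intros assms)
  moreover have "foldl (\<lambda>y e. y \<or> P e x) b m = (b \<or> (\<exists>e\<in>set m. P e x))" for b x m
    by (induction m arbitrary: b) auto
  ultimately show ?thesis by simp
qed

lemma computable_mem [computable_intros]:
  assumes "computable f" "computable l"
  shows "computable (\<lambda>x. f x \<in> set (l x))"
proof -
  have "computable (\<lambda>x. \<exists>e\<in>set (l x). e = f x)"
    by (intro computable_Bex_set computable_eq computable_comp[OF assms(1)] computable_intros assms)
  then show ?thesis by simp
qed

lemma computable_drop [computable_intros]:
  assumes "computable n" "computable l"
  shows "computable (\<lambda>x. drop (n x) (l x))"
proof -
  have "computable (\<lambda>x. ((\<lambda>y. tl y) ^^ n x) (l x))"
    by (intro computable_funpow computable_intros assms)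
  moreover have "((\<lambda>y. tl y) ^^ k) m = drop k m" for k and m :: "'b list"
    by (induction k) (auto simp: drop_Suc drop_tl)
  ultimately show ?thesis by simp
qed

section \<open>An undecidable projection of a decidable relation\<close>

fun recf_code :: "recf \<Rightarrow> nat" where
  "recf_code Zero = prod_encode (0, 0)"
| "recf_code Succ = prod_encode (1, 0)"
| "recf_code (Proj i) = prod_encode (2, i)"
| "recf_code (Comp f gs) =
     prod_encode (3, prod_encode (recf_code f, list_encode (map recf_code gs)))"
| "recf_code (PrimRec f g) = prod_encode (4, prod_encode (recf_code f, recf_code g))"
| "recf_code (Mu f) = prod_encode (5, recf_code f)"

text \<open>A fact \<open>(p, xs, y)\<close> asserts that the program with code \<open>p\<close> returns \<open>y\<close> on input \<open>xs\<close>;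
  \<open>justified S\<close> mirrors the rules of \<^const>\<open>rec_eval\<close>, with premises taken from \<open>S\<close>.\<close>

type_synonym fact = "nat \<times> nat list \<times> nat"

definition justified :: "fact list \<Rightarrow> fact \<Rightarrow> bool" where
  "justified S e = (let p = fst e; xs = fst (snd e); y = snd (snd e);
       c = fst (prod_decode p); b = snd (prod_decode p);
       f = fst (prod_decode b); g = snd (prod_decode b) in
     c = 0 \<and> y = 0 \<or>
     c = 1 \<and> length xs = 1 \<and> y = Suc (hd xs) \<or>
     c = 2 \<and> b < length xs \<and> y = hd (drop b xs) \<or>
     c = 3 \<and> (\<exists>d\<in>set S. fst d = f \<and> snd (snd d) = y \<and>
        length (list_decode g) = length (fst (snd d)) \<and>
        (\<forall>i<length (list_decode g).
           (hd (drop i (list_decode g)), xs, hd (drop i (fst (snd d)))) \<in> set S)) \<or>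
     c = 4 \<and> xs \<noteq> [] \<and> hd xs = 0 \<and> (f, tl xs, y) \<in> set S \<or>
     c = 4 \<and> xs \<noteq> [] \<and> hd xs \<noteq> 0 \<and> (\<exists>d\<in>set S. fst d = p \<and> fst (snd d) = (hd xs - 1) # tl xs \<and>
        (g, (hd xs - 1) # snd (snd d) # tl xs, y) \<in> set S) \<or>
     c = 5 \<and> (b, y # xs, 0) \<in> set S \<and>
        (\<forall>m<y. \<exists>d\<in>set S. fst d = b \<and> fst (snd d) = m # xs \<and> snd (snd d) > 0))"

text \<open>Each fact may use only the facts behind it in the list, which excludes circular
  justifications; the newest conclusion stands in front.\<close>

definition valid :: "fact list \<Rightarrow> bool" where
  "valid S \<longleftrightarrow> (\<forall>i<length S. justified (drop (Suc i) S) (hd (drop i S)))"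

lemma valid_Nil: "valid []"
  by (simp add: valid_def)

lemma valid_Cons: "valid (e # S) \<longleftrightarrow> justified S e \<and> valid S"
  by (simp add: valid_def All_less_Suc2)

lemma computable_justified:
  assumes "computable S" "computable e"
  shows "computable (\<lambda>x. justified (S x) (e x))"
proof -
  have "computable (\<lambda>p. justified (fst p) (snd p))"
    unfolding justified_def Let_def by (intro computable_intros)
  from computable_comp2[OF this assms] show ?thesis .
qed

lemma computable_valid: "computable S \<Longrightarrow> computable (\<lambda>x. valid (S x))"
proof (rule computable_comp[of valid])
  show "computable valid"
    unfolding valid_def[abs_def] by (intro computable_intros computable_justified)
qed

text \<open>All conditions on \<open>S\<close> are positive: they only ask that certain facts occur
  in it.\<close>

lemma justified_mono: "justified S e \<Longrightarrow> set S \<subseteq> set S' \<Longrightarrow> justified S' e"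
  unfolding justified_def Let_def subset_eq by (elim disjE) (auto, blast+)

lemma valid_append: "valid S \<Longrightarrow> valid S' \<Longrightarrow> valid (S @ S')"
  by (induction S) (auto simp: valid_Cons intro: justified_mono)

text \<open>The head of the list is justified by facts of the tail, for which the induction
  hypothesis holds with arbitrary programs and inputs. Inverting \<open>justified\<close> at the
  code of \<open>r\<close> then yields the matching evaluation rule.\<close>

lemma valid_sound: "valid S \<Longrightarrow> (recf_code r, xs, y) \<in> set S \<Longrightarrow> rec_eval r xs y"
proof (induction S arbitrary: r xs y)
  case (Cons e S)
  have IH: "\<And>r xs y. (recf_code r, xs, y) \<in> set S \<Longrightarrow> rec_eval r xs y"
    using Cons by (simp add: valid_Cons)
  show ?case
  proof (cases "e = (recf_code r, xs, y)")
    case True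
    then have j: "justified S (recf_code r, xs, y)"
      using Cons.prems by (simp add: valid_Cons)
    show ?thesis
    proof (cases r)
      case Zero
      then show ?thesis using j by (auto simp: justified_def Let_def intro: rec_eval.zero)
    next
      case Succ
      then show ?thesis
        using j by (auto simp: justified_def Let_def length_Suc_conv intro: rec_eval.succ)
    next
      case (Proj i)
      then show ?thesis
        using j by (auto simp: justified_def Let_def hd_drop_conv_nth intro: rec_eval.proj)
    next
      case (Comp f gs)
      then obtain ys where ys: "(recf_code f, ys, y) \<in> set S" "length gs = length ys"
        "\<forall>i<length gs. (hd (drop i (map recf_code gs)), xs, hd (drop i ys)) \<in> set S"
        using j by (auto simp: justified_def Let_def)
      have "list_all2 (\<lambda>g y. rec_eval g xs y) gs ys"
        using ys(2,3) by (auto simp: list_all2_conv_all_nth hd_drop_conv_nth intro!: IH)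
      then show ?thesis using IH[OF ys(1)] Comp by (auto intro: rec_eval.comp)
    next
      case (PrimRec f g)
      consider (z) zs where "xs = 0 # zs" "(recf_code f, zs, y) \<in> set S"
        | (s) n zs u where "xs = Suc n # zs" "(recf_code (PrimRec f g), n # zs, u) \<in> set S"
            "(recf_code g, n # u # zs, y) \<in> set S"
      proof (cases xs)
        case (Cons k zs)
        then show thesis
          using j PrimRec that by (cases k) (auto simp: justified_def Let_def)
      qed (use j PrimRec in \<open>auto simp: justified_def Let_def\<close>)
      then show ?thesis
      proof cases
        case z
        then show ?thesis using IH PrimRec by (auto intro: rec_eval.primrec_0)
      next
        case s
        then show ?thesis using IH[OF s(2)] IH[OF s(3)] PrimRec
          by (auto intro: rec_eval.primrec_Suc)
      qed
    next
      case (Mu f)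
      then have z: "(recf_code f, y # xs, 0) \<in> set S"
        and p: "\<forall>m<y. \<exists>d\<in>set S. fst d = recf_code f \<and> fst (snd d) = m # xs \<and> snd (snd d) > 0"
        using j by (simp_all add: justified_def Let_def)
      have "\<forall>m<y. \<exists>u>0. rec_eval f (m # xs) u"
      proof (intro allI impI)
        fix m assume "m < y"
        then obtain d where d: "d \<in> set S" "fst d = recf_code f" "fst (snd d) = m # xs" "snd (snd d) > 0"
          using p by blast
        then have "rec_eval f (m # xs) (snd (snd d))" by (intro IH) (cases d, simp)
        then show "\<exists>u>0. rec_eval f (m # xs) u" using d(4) by blast
      qed
      then show ?thesis using IH[OF z] Mu by (simp add: rec_eval.mu)
    qed
  next
    case False
    then show ?thesis using Cons.prems IH by auto
  qed
qed simp

definition derivable :: "fact \<Rightarrow> bool" where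
  "derivable e \<longleftrightarrow> (\<exists>S. valid S \<and> e \<in> set S)"

lemma finite_derivable:
  assumes "finite A" "\<And>e. e \<in> A \<Longrightarrow> derivable e"
  obtains S where "valid S" "A \<subseteq> set S"
proof -
  have "\<exists>S. valid S \<and> A \<subseteq> set S"
    using assms
  proof (induction rule: finite_induct)
    case empty
    then show ?case using valid_Nil by auto
  next
    case (insert e A)
    then obtain S where "valid S" "A \<subseteq> set S" by blast
    moreover obtain S' where "valid S'" "e \<in> set S'"
      using insert.prems[of e] unfolding derivable_def by blast
    ultimately show ?case by (intro exI[of _ "S @ S'"]) (auto intro: valid_append)
  qed
  then show thesis using that by blast
qed

text \<open>\<open>A\<close> collects the premises of one evaluation rule; their finitely many
  derivations are concatenated and the conclusion is put in front.\<close>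

lemma derivable_step:
  assumes "finite A" "\<And>e. e \<in> A \<Longrightarrow> derivable e" "\<And>S. A \<subseteq> set S \<Longrightarrow> justified S e"
  shows "derivable e"
proof -
  obtain S where "valid S" "A \<subseteq> set S" by (rule finite_derivable[OF assms(1,2)])
  then have "valid (e # S)" using assms(3) by (simp add: valid_Cons)
  then show ?thesis unfolding derivable_def by (intro exI[of _ "e # S"]) simp
qed

lemma rec_eval_derivable: "rec_eval r xs y \<Longrightarrow> derivable (recf_code r, xs, y)"
proof (induction rule: rec_eval.induct)
  case (zero xs)
  show ?case by (rule derivable_step[of "{}"]) (simp_all add: justified_def)
next
  case (succ x)
  show ?case by (rule derivable_step[of "{}"]) (simp_all add: justified_def)
next
  case (proj i xs)
  then have "justified S (recf_code (Proj i), xs, xs ! i)" for S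
    by (simp add: justified_def hd_drop_conv_nth)
  then show ?case by (rule derivable_step[of "{}", rotated 2]) simp_all
next
  case (comp xs gs ys f z)
  let ?A = "insert (recf_code f, ys, z) ((\<lambda>i. (recf_code (gs ! i), xs, ys ! i)) ` {..<length gs})"
  have l: "length gs = length ys" using comp.IH(1) by (rule list_all2_lengthD)
  show ?case
  proof (rule derivable_step[of ?A])
    have "derivable (recf_code (gs ! i), xs, ys ! i)" if "i < length gs" for i
      using list_all2_nthD[OF comp.IH(1) that] by simp
    then show "derivable e" if "e \<in> ?A" for e
      using that comp.IH(2) by blast
    fix S assume S: "?A \<subseteq> set S"
    have "(hd (drop i (map recf_code gs)), xs, hd (drop i ys)) \<in> set S" if "i < length gs" for i
      using S that l by (auto simp: hd_drop_conv_nth)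
    then have "\<exists>d\<in>set S. fst d = recf_code f \<and> snd (snd d) = z \<and>
        length (map recf_code gs) = length (fst (snd d)) \<and>
        (\<forall>i<length (map recf_code gs).
           (hd (drop i (map recf_code gs)), xs, hd (drop i (fst (snd d)))) \<in> set S)"
      using S l by (intro bexI[of _ "(recf_code f, ys, z)"]) simp_all
    then show "justified S (recf_code (Comp f gs), xs, z)"
      by (simp add: justified_def Let_def)
  qed simp
next
  case (primrec_0 f xs y g)
  show ?case
    by (rule derivable_step[of "{(recf_code f, xs, y)}"])
      (use primrec_0.IH in \<open>simp_all add: justified_def Let_def\<close>)
next
  case (primrec_Suc f g n xs y z)
  let ?A = "{(recf_code (PrimRec f g), n # xs, y), (recf_code g, n # y # xs, z)}"
  show ?case
  proof (rule derivable_step[of ?A])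
    fix S assume S: "?A \<subseteq> set S"
    then have "\<exists>d\<in>set S. fst d = recf_code (PrimRec f g) \<and> fst (snd d) = n # xs \<and>
        (recf_code g, n # snd (snd d) # xs, z) \<in> set S"
      by (intro bexI[of _ "(recf_code (PrimRec f g), n # xs, y)"]) simp_all
    then show "justified S (recf_code (PrimRec f g), Suc n # xs, z)"
      by (simp add: justified_def Let_def)
  qed (use primrec_Suc.IH in auto)
next
  case (mu f n xs)
  then have "\<forall>m. \<exists>y. m < n \<longrightarrow> y > 0 \<and> derivable (recf_code f, m # xs, y)" by blast
  \<comment> \<open>The values for the finitely many \<open>m < n\<close> are fixed once, so that
    the premises form a finite set.\<close>
  from choice[OF this] obtain u where
    u: "\<And>m. m < n \<Longrightarrow> u m > 0 \<and> derivable (recf_code f, m # xs, u m)" by blast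
  let ?A = "insert (recf_code f, n # xs, 0) ((\<lambda>m. (recf_code f, m # xs, u m)) ` {..<n})"
  show ?case
  proof (rule derivable_step[of ?A])
    show "derivable e" if "e \<in> ?A" for e
      using that mu.IH(1) u by blast
    fix S assume S: "?A \<subseteq> set S"
    have "\<exists>d\<in>set S. fst d = recf_code f \<and> fst (snd d) = m # xs \<and> snd (snd d) > 0"
      if "m < n" for m
      using S that u by (intro bexI[of _ "(recf_code f, m # xs, u m)"]) auto
    then show "justified S (recf_code (Mu f), xs, n)"
      using S by (simp add: justified_def Let_def)
  qed simp
qed

text \<open>\<open>t\<close> is the code of a derivation showing that program \<open>n\<close> returns \<open>0\<close> on its own code.\<close>

definition halts :: "nat \<Rightarrow> nat \<Rightarrow> bool" where
  "halts n t \<longleftrightarrow> (\<exists>S. enc S = t \<and> valid S \<and> (n, [n], 0) \<in> set S)"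

lemma surj_enc_nat: "surj (enc :: nat \<Rightarrow> nat)"
  by (auto intro: surjI[of _ id])

lemma surj_enc_prod:
  assumes "surj (enc :: 'a::enc \<Rightarrow> nat)" "surj (enc :: 'b::enc \<Rightarrow> nat)"
  shows "surj (enc :: 'a \<times> 'b \<Rightarrow> nat)"
proof (rule surjI)
  show "enc (inv_into UNIV (enc :: 'a \<Rightarrow> nat) (fst (prod_decode n)),
    inv_into UNIV (enc :: 'b \<Rightarrow> nat) (snd (prod_decode n))) = n" for n
    using assms by (simp add: enc_prod_def surj_f_inv_f)
qed

lemma surj_enc_list:
  assumes "surj (enc :: 'a::enc \<Rightarrow> nat)"
  shows "surj (enc :: 'a list \<Rightarrow> nat)"
proof (rule surjI)
  show "enc (map (inv_into UNIV (enc :: 'a \<Rightarrow> nat)) (list_decode n)) = n" for n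
    using assms by (simp add: enc_list_def surj_f_inv_f o_def)
qed

text \<open>Every number is the code of a list of facts, so a right inverse of \<open>enc\<close>
  acts as the identity on codes and is computable at once. This makes \<open>halts\<close>
  decidable.\<close>

lemma surj_enc_fact_list: "surj (enc :: fact list \<Rightarrow> nat)"
  by (intro surj_enc_list surj_enc_prod surj_enc_nat)

lemma computable_halts [computable_intros]:
  assumes "computable f" "computable g"
  shows "computable (\<lambda>x. halts (f x) (g x))"
proof -
  define D where "D = inv_into UNIV (enc :: fact list \<Rightarrow> nat)"
  have D: "enc (D t) = t" for t
    unfolding D_def by (rule surj_f_inv_f[OF surj_enc_fact_list])
  have "computable D" by (rule computable_same_code) (simp add: D)
  have "halts n t \<longleftrightarrow> valid (D t) \<and> (n, [n], 0) \<in> set (D t)" for n t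
    unfolding halts_def using D enc_eq_iff[of _ "D t", unfolded D] by auto
  moreover have "computable (\<lambda>x. valid (D (g x)) \<and> (f x, [f x], 0) \<in> set (D (g x)))"
    by (intro computable_intros computable_valid computable_comp[OF \<open>computable D\<close>] assms)
  ultimately show ?thesis by simp
qed

text \<open>A diagonal argument. The answer "no" of a decision program is the output
  \<open>0\<close>, and \<open>halts\<close> asks for output \<open>0\<close> on the own code; a
  decider applied to its own code would thus answer "no" exactly when it does not.\<close>

theorem halts_undecidable: "\<not> computable (\<lambda>n. \<exists>t. halts n t)"
proof
  assume "computable (\<lambda>n. \<exists>t. halts n t)"
  then obtain r where r: "\<And>n. rec_eval r [n] (enc (\<exists>t. halts n t))"
    unfolding computable_def by auto
  let ?n = "recf_code r"
  have "(\<exists>t. halts ?n t) \<longleftrightarrow> rec_eval r [?n] 0"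
    using valid_sound rec_eval_derivable unfolding halts_def derivable_def by blast
  also have "\<dots> \<longleftrightarrow> \<not> (\<exists>t. halts ?n t)"
    using r[of ?n] rec_eval_deterministic[OF r[of ?n], of 0]
    by (cases "\<exists>t. halts ?n t") (auto simp: enc_bool_def)
  finally show False by blast
qed

section \<open>The group \<open>F\<close>\<close>

definition breaks :: "(real \<Rightarrow> real) \<Rightarrow> real set \<Rightarrow> bool" where
  "breaks f B \<longleftrightarrow> finite B \<and> B \<subseteq> dyadic_rationals \<inter> {0<..<1} \<and>
     (\<forall>a b. 0 \<le> a \<and> a < b \<and> b \<le> 1 \<and> {a<..<b} \<inter> B = {} \<longrightarrow>
        (\<exists>k :: int. \<forall>x\<in>{a..b}. f x = f a + 2 powi k * (x - a)))"

lemma thompson_F_set_iff: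
  "f \<in> thompson_F_set \<longleftrightarrow>
     f \<in> extensional {0..1} \<and> (\<exists>g. homeomorphism {0..1} {0..1} f g) \<and> (\<exists>B. breaks f B)"
  by (simp add: thompson_F_set_def breaks_def)

lemma breaks_finite: "breaks f B \<Longrightarrow> finite B"
  by (simp add: breaks_def)

lemma breaks_mem: "breaks f B \<Longrightarrow> x \<in> B \<Longrightarrow> x \<in> dyadic_rationals \<and> 0 < x \<and> x < 1"
  unfolding breaks_def by auto

lemma breaksE:
  assumes "breaks f B" "0 \<le> a" "a < b" "b \<le> 1" "{a<..<b} \<inter> B = {}"
  obtains k :: int where "\<And>x. a \<le> x \<Longrightarrow> x \<le> b \<Longrightarrow> f x = f a + 2 powi k * (x - a)"
  using assms unfolding breaks_def by (metis atLeastAtMost_iff)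

lemma breaks_step:
  assumes "breaks f B" "0 \<le> a" "a < b" "b \<le> 1" "{a<..<b} \<inter> B = {}"
  obtains k :: int where "f b = f a + 2 powi k * (b - a)"
proof -
  obtain k :: int where "\<And>x. a \<le> x \<Longrightarrow> x \<le> b \<Longrightarrow> f x = f a + 2 powi k * (x - a)"
    by (rule breaksE[OF assms]) blast
  from this[of b] show thesis using that assms(3) by simp
qed

text \<open>Induction on the number of points of \<open>B\<close> strictly inside the interval. It
  transfers to long intervals whatever holds on linear pieces and survives concatenation, such as
  monotonicity or dyadic increments.\<close>

lemma interval_split_induct:
  assumes "finite B" "x < y"
    and "\<And>x y. x < y \<Longrightarrow> {x<..<y} \<inter> B = {} \<Longrightarrow> P x y"
    and "\<And>x b y. x < b \<Longrightarrow> b < y \<Longrightarrow> b \<in> B \<Longrightarrow> P x b \<Longrightarrow> P b y \<Longrightarrow> P x y"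
  shows "P x (y :: real)"
  using assms(2)
proof (induction "card ({x<..<y} \<inter> B)" arbitrary: x y rule: less_induct)
  case less
  show ?case
  proof (cases "{x<..<y} \<inter> B = {}")
    case True
    then show ?thesis using less.prems assms(3) by blast
  next
    case False
    then obtain b where b: "x < b" "b < y" "b \<in> B" by auto
    have "card ({x<..<b} \<inter> B) < card ({x<..<y} \<inter> B)" "card ({b<..<y} \<inter> B) < card ({x<..<y} \<inter> B)"
      using b assms(1) by (auto intro!: psubset_card_mono)
    then show ?thesis using assms(4) less.hyps b by blast
  qed
qed

lemma thompson_F_bij_betw:
  assumes "f \<in> thompson_F_set"
  shows "bij_betw f {0..1} {0..1}"
proof -
  obtain g where "homeomorphism {0..1} {0..1} f g" using assms by (auto simp: thompson_F_set_iff)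
  then have "f ` {0..1} = {0..1}" "\<And>x. x \<in> {0..1} \<Longrightarrow> g (f x) = x"
    by (simp_all add: homeomorphism_def)
  then show ?thesis unfolding bij_betw_def using inj_on_inverseI[of "{0..1}" g f] by blast
qed

lemma thompson_F_strict_mono:
  assumes "f \<in> thompson_F_set" "0 \<le> x" "x < y" "y \<le> 1"
  shows "f x < f y"
proof -
  obtain B where B: "breaks f B" using assms(1) by (auto simp: thompson_F_set_iff)
  then have "finite B" by (simp add: breaks_def)
  then have "0 \<le> x \<longrightarrow> y \<le> 1 \<longrightarrow> f x < f y"
    using assms(3)
  proof (rule interval_split_induct)
    fix x y :: real assume xy: "x < y" "{x<..<y} \<inter> B = {}"
    show "0 \<le> x \<longrightarrow> y \<le> 1 \<longrightarrow> f x < f y"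
    proof (intro impI)
      assume "0 \<le> x" "y \<le> 1"
      then obtain k where "f y = f x + 2 powi k * (y - x)"
        using breaks_step[OF B _ xy(1) _ xy(2)] by blast
      then show "f x < f y" using xy(1) by simp
    qed
  qed auto
  then show ?thesis using assms by simp
qed

lemma thompson_F_mono_iff:
  assumes "f \<in> thompson_F_set" "x \<in> {0..1}" "y \<in> {0..1}"
  shows "f x < f y \<longleftrightarrow> x < y"
  using thompson_F_strict_mono[OF assms(1), of x y] thompson_F_strict_mono[OF assms(1), of y x] assms(2,3)
  by (cases x y rule: linorder_cases) auto

lemma thompson_F_closed: "f \<in> thompson_F_set \<Longrightarrow> x \<in> {0..1} \<Longrightarrow> f x \<in> {0..1}"
  by (rule bij_betw_apply[OF thompson_F_bij_betw])

lemma thompson_F_surj: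
  assumes "f \<in> thompson_F_set" "y \<in> {0..1}"
  obtains x where "x \<in> {0..1}" "f x = y"
  using thompson_F_bij_betw[OF assms(1)] assms(2) by (metis bij_betw_imp_surj_on imageE)

lemma thompson_F_0: assumes "f \<in> thompson_F_set" shows "f 0 = 0"
proof -
  obtain x where x: "x \<in> {0..1}" "f x = 0" using thompson_F_surj[OF assms, of 0] by auto
  then show ?thesis
    using thompson_F_mono_iff[OF assms, of 0 x] thompson_F_closed[OF assms, of 0] by fastforce
qed

lemma thompson_F_1: assumes "f \<in> thompson_F_set" shows "f 1 = 1"
proof -
  obtain x where x: "x \<in> {0..1}" "f x = 1" using thompson_F_surj[OF assms, of 1] by auto
  then show ?thesis
    using thompson_F_mono_iff[OF assms, of x 1] thompson_F_closed[OF assms, of 1] by fastforce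
qed

lemma thompson_F_interior: 
  assumes "f \<in> thompson_F_set" "x \<in> {0<..<1}" shows "f x \<in> {0<..<1}"
  using thompson_F_strict_mono[OF assms(1), of 0 x] thompson_F_strict_mono[OF assms(1), of x 1]
    thompson_F_0[OF assms(1)] thompson_F_1[OF assms(1)] assms(2) by auto

section \<open>Dyadic numbers under elements of F\<close>

lemma dyadicI: "x = of_int m / 2 ^ n \<Longrightarrow> x \<in> dyadic_rationals"
  unfolding dyadic_rationals_def by blast

lemma dyadic_add: "x \<in> dyadic_rationals \<Longrightarrow> y \<in> dyadic_rationals \<Longrightarrow> x + y \<in> dyadic_rationals"
proof -
  assume "x \<in> dyadic_rationals" "y \<in> dyadic_rationals"
  then obtain m n m' n' where "x = of_int m / 2 ^ n" "y = of_int m' / 2 ^ n'"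
    unfolding dyadic_rationals_def by auto
  then have "x + y = of_int (m * 2 ^ n' + m' * 2 ^ n) / 2 ^ (n + n')"
    by (simp add: add_frac_eq power_add)
  then show ?thesis unfolding dyadic_rationals_def by blast
qed

lemma dyadic_int_mult:
  assumes "x \<in> dyadic_rationals"
  shows "of_int c * x \<in> dyadic_rationals"
proof -
  obtain m n where "x = of_int m / 2 ^ n" using assms unfolding dyadic_rationals_def by auto
  then have "of_int c * x = of_int (c * m) / 2 ^ n" by simp
  then show ?thesis unfolding dyadic_rationals_def by blast
qed

lemma dyadic_minus: "x \<in> dyadic_rationals \<Longrightarrow> - x \<in> dyadic_rationals"
  using dyadic_int_mult[of x "-1"] by simp

lemma dyadic_diff: "x \<in> dyadic_rationals \<Longrightarrow> y \<in> dyadic_rationals \<Longrightarrow> x - y \<in> dyadic_rationals"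
  using dyadic_add[OF _ dyadic_minus, of x y] by simp

lemma dyadic_powi_mult: "x \<in> dyadic_rationals \<Longrightarrow> 2 powi k * x \<in> dyadic_rationals"
proof -
  assume "x \<in> dyadic_rationals"
  then obtain m n where x: "x = of_int m / 2 ^ n" unfolding dyadic_rationals_def by auto
  show ?thesis
  proof (cases k rule: int_cases2)
    case (nonneg j)
    then have "2 powi k * x = of_int (m * 2 ^ j) / 2 ^ n"
      using x by simp
    then show ?thesis unfolding dyadic_rationals_def by blast
  next
    case (nonpos j)
    then have "2 powi k * x = of_int m / 2 ^ (n + j)"
      using x by (simp add: power_int_minus power_add divide_inverse)
    then show ?thesis unfolding dyadic_rationals_def by blast
  qed
qed

lemma dyadic_0_1: "0 \<in> dyadic_rationals" "1 \<in> dyadic_rationals"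
proof -
  have "0 = real_of_int 0 / 2 ^ 0" "1 = real_of_int 1 / 2 ^ 0" by simp_all
  then show "0 \<in> dyadic_rationals" "1 \<in> dyadic_rationals"
    unfolding dyadic_rationals_def by blast+
qed

lemma piece_left:
  assumes "f \<in> thompson_F_set" "breaks f B" "0 < x" "x \<le> 1"
  obtains b k where "b \<in> insert 0 B" "b < x" "f x = f b + 2 powi k * (x - b)"
proof -
  define C where "C = {b \<in> insert 0 B. b < x}"
  have C: "finite C" "C \<noteq> {}" using assms by (auto simp: C_def breaks_def)
  define b where "b = Max C"
  have b: "b \<in> insert 0 B" "b < x" using Max_in[OF C] by (auto simp: b_def C_def)
  have disj: "{b<..<x} \<inter> B = {}"
  proof (rule ccontr)
    assume "{b<..<x} \<inter> B \<noteq> {}"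
    then obtain y where y: "b < y" "y < x" "y \<in> B" by auto
    then have "y \<in> C" by (simp add: C_def)
    then show False using Max_ge[OF C(1)] y(1) unfolding b_def by fastforce
  qed
  have b0: "0 \<le> b" using b assms(2) by (auto simp: breaks_def)
  obtain k :: int where "f x = f b + 2 powi k * (x - b)"
    by (rule breaks_step[OF assms(2) b0 b(2) assms(4) disj])
  then show thesis by (rule that[OF b])
qed

lemma thompson_F_dyadic:
  assumes "f \<in> thompson_F_set" "x \<in> {0..1}" "x \<in> dyadic_rationals"
  shows "f x \<in> dyadic_rationals"
proof (cases "x = 0")
  case True
  then show ?thesis using thompson_F_0[OF assms(1)] dyadic_0_1 by simp
next
  case False
  obtain B where B: "breaks f B" using assms(1) by (auto simp: thompson_F_set_iff)
  then have fin: "finite B" by (simp add: breaks_def)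
  have "0 < x" using False assms(2) by simp
  with fin have "x \<in> dyadic_rationals \<longrightarrow> 0 \<in> dyadic_rationals \<longrightarrow> 0 \<le> (0::real) \<longrightarrow> x \<le> 1 \<longrightarrow> f x - f 0 \<in> dyadic_rationals"
  proof (rule interval_split_induct[where P = "\<lambda>x y. y \<in> dyadic_rationals \<longrightarrow> x \<in> dyadic_rationals \<longrightarrow>
      0 \<le> x \<longrightarrow> y \<le> 1 \<longrightarrow> f y - f x \<in> dyadic_rationals"])
    fix x y :: real assume xy: "x < y" "{x<..<y} \<inter> B = {}"
    show "y \<in> dyadic_rationals \<longrightarrow> x \<in> dyadic_rationals \<longrightarrow> 0 \<le> x \<longrightarrow> y \<le> 1 \<longrightarrow>
        f y - f x \<in> dyadic_rationals"
    proof (intro impI)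
      assume d: "y \<in> dyadic_rationals" "x \<in> dyadic_rationals" and "0 \<le> x" "y \<le> 1"
      then obtain k where "f y = f x + 2 powi k * (y - x)"
        using breaks_step[OF B _ xy(1) _ xy(2)] by blast
      then show "f y - f x \<in> dyadic_rationals" using d by (simp add: dyadic_powi_mult dyadic_diff)
    qed
  next
    fix x b y :: real
    assume "x < b" "b < y" "b \<in> B"
      and IH: "b \<in> dyadic_rationals \<longrightarrow> x \<in> dyadic_rationals \<longrightarrow> 0 \<le> x \<longrightarrow> b \<le> 1 \<longrightarrow> f b - f x \<in> dyadic_rationals"
        "y \<in> dyadic_rationals \<longrightarrow> b \<in> dyadic_rationals \<longrightarrow> 0 \<le> b \<longrightarrow> y \<le> 1 \<longrightarrow> f y - f b \<in> dyadic_rationals"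
    moreover have "b \<in> dyadic_rationals" using \<open>b \<in> B\<close> B by (auto simp: breaks_def)
    ultimately show "y \<in> dyadic_rationals \<longrightarrow> x \<in> dyadic_rationals \<longrightarrow> 0 \<le> x \<longrightarrow> y \<le> 1 \<longrightarrow>
        f y - f x \<in> dyadic_rationals"
      using dyadic_add[of "f y - f b" "f b - f x"] by auto
  qed
  then show ?thesis using assms thompson_F_0[OF assms(1)] dyadic_0_1 by simp
qed

text \<open>The converse direction is what composition requires: breakpoints of \<open>f\<close>
  pulled back along \<open>g\<close> must again be dyadic. On the piece to the left of
  \<open>x\<close> the map is inverted by dividing by a power of 2.\<close>

lemma thompson_F_dyadic_iff:
  assumes "f \<in> thompson_F_set" "x \<in> {0..1}"
  shows "f x \<in> dyadic_rationals \<longleftrightarrow> x \<in> dyadic_rationals"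
proof
  assume fx: "f x \<in> dyadic_rationals"
  show "x \<in> dyadic_rationals"
  proof (cases "x = 0")
    case False
    obtain B where B: "breaks f B" using assms(1) by (auto simp: thompson_F_set_iff)
    obtain b k where b: "b \<in> insert 0 B" "b < x" "f x = f b + 2 powi k * (x - b)"
      using piece_left[OF assms(1) B, of x] False assms(2) by auto
    have "b \<in> dyadic_rationals" "b \<in> {0..1}"
      using b(1) B dyadic_0_1 by (auto simp: breaks_def)
    then have "f b \<in> dyadic_rationals" using thompson_F_dyadic[OF assms(1)] by blast
    have "b + 2 powi (- k) * (f x - f b) = x"
      using b(3) by (simp add: power_int_minus mult.assoc[symmetric])
    moreover have "b + 2 powi (- k) * (f x - f b) \<in> dyadic_rationals"
      by (intro dyadic_add dyadic_powi_mult dyadic_diff fx) fact+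
    ultimately show ?thesis by simp
  qed (simp add: dyadic_0_1)
qed (use assms thompson_F_dyadic in blast)

section \<open>F as a group\<close>

lemma thompson_F_compose:
  assumes f: "f \<in> thompson_F_set" and g: "g \<in> thompson_F_set"
  shows "compose {0..1} f g \<in> thompson_F_set"
  unfolding thompson_F_set_iff
proof (intro conjI)
  show "compose {0..1} f g \<in> extensional {0..1}" by (rule compose_extensional)
  obtain f' where f': "homeomorphism {0..1} {0..1} f f'" using f by (auto simp: thompson_F_set_iff)
  obtain g' where g': "homeomorphism {0..1} {0..1} g g'" using g by (auto simp: thompson_F_set_iff)
  have "homeomorphism {0..1} {0..1} (compose {0..1} f g) (g' \<circ> f')"
    by (rule homeomorphism_cong[OF homeomorphism_compose[OF g' f']]) (auto simp: compose_def)
  then show "\<exists>h. homeomorphism {0..1} {0..1} (compose {0..1} f g) h" by blast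
  obtain B where B: "breaks f B" using f by (auto simp: thompson_F_set_iff)
  obtain C where C: "breaks g C" using g by (auto simp: thompson_F_set_iff)
  \<comment> \<open>The composition can break where \<open>g\<close> breaks or where
    \<open>g\<close> takes a breakpoint of \<open>f\<close> as its value.\<close>
  define D where "D = C \<union> (g -` B \<inter> {0..1})"
  have "inj_on g {0..1}" using thompson_F_bij_betw[OF g] by (rule bij_betw_imp_inj_on)
  then have "finite D"
    unfolding D_def using finite_vimage_IntI[OF breaks_finite[OF B]] breaks_finite[OF C] by blast
  have D: "D \<subseteq> dyadic_rationals \<inter> {0<..<1}"
  proof
    fix x assume "x \<in> D"
    then consider "x \<in> C" | "x \<in> {0..1}" "g x \<in> B" unfolding D_def by blast
    then show "x \<in> dyadic_rationals \<inter> {0<..<1}"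
    proof cases
      case 1
      then show ?thesis using breaks_mem[OF C] by simp
    next
      case 2
      then show ?thesis
        using breaks_mem[OF B 2(2)] thompson_F_dyadic_iff[OF g 2(1)] thompson_F_0[OF g] thompson_F_1[OF g]
          thompson_F_mono_iff[OF g _ 2(1), of 0] thompson_F_mono_iff[OF g 2(1), of 1] by simp
    qed
  qed
  have "breaks (compose {0..1} f g) D"
    unfolding breaks_def
  proof (intro conjI allI impI)
    fix a b assume ab: "0 \<le> a \<and> a < b \<and> b \<le> 1 \<and> {a<..<b} \<inter> D = {}"
    then have ab': "0 \<le> a" "a < b" "b \<le> 1" by simp_all
    have "{a<..<b} \<inter> D = {}" using ab by simp
    then have disj: "{a<..<b} \<inter> C = {}" unfolding D_def by blast
    obtain k :: int where k: "\<And>x. a \<le> x \<Longrightarrow> x \<le> b \<Longrightarrow> g x = g a + 2 powi k * (x - a)"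
      by (rule breaksE[OF C ab' disj]) blast
    have I: "a \<in> {0..1}" "b \<in> {0..1}" using ab by auto
    have gab: "g a < g b" using thompson_F_mono_iff[OF g I] ab by simp
    have disj': "{g a<..<g b} \<inter> B = {}"
    proof (rule ccontr)
      assume "{g a<..<g b} \<inter> B \<noteq> {}"
      then obtain y where y: "g a < y" "y < g b" "y \<in> B" by auto
      then have "y \<in> {0..1}" using thompson_F_closed[OF g I(1)] thompson_F_closed[OF g I(2)] by auto
      then obtain x where x: "x \<in> {0..1}" "g x = y" using thompson_F_surj[OF g] by blast
      then have "a < x" "x < b"
        using y thompson_F_mono_iff[OF g I(1) x(1)] thompson_F_mono_iff[OF g x(1) I(2)] by auto
      moreover have "x \<in> D" using x y by (simp add: D_def)
      ultimately show False using \<open>{a<..<b} \<inter> D = {}\<close> by auto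
    qed
    have "0 \<le> g a" "g b \<le> 1" using thompson_F_closed[OF g] I by auto
    then obtain l :: int where
      l: "\<And>y. g a \<le> y \<Longrightarrow> y \<le> g b \<Longrightarrow> f y = f (g a) + 2 powi l * (y - g a)"
      by (rule breaksE[OF B _ gab _ disj']) blast
    have "compose {0..1} f g x = compose {0..1} f g a + 2 powi (l + k) * (x - a)" if x: "x \<in> {a..b}" for x
    proof -
      have "x \<in> {0..1}" using x ab by auto
      have "g a \<le> g x" "g x \<le> g b"
        using x thompson_F_mono_iff[OF g \<open>x \<in> {0..1}\<close> I(1)] thompson_F_mono_iff[OF g I(2) \<open>x \<in> {0..1}\<close>]
        by auto
      then have "f (g x) = f (g a) + 2 powi l * (g x - g a)" by (rule l)
      also have "g x - g a = 2 powi k * (x - a)" using k[of x] x by simp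
      finally show ?thesis using \<open>x \<in> {0..1}\<close> I by (simp add: compose_def power_int_add)
    qed
    then show "\<exists>k. \<forall>x\<in>{a..b}. compose {0..1} f g x = compose {0..1} f g a + 2 powi k * (x - a)"
      by blast
  qed (rule \<open>finite D\<close> D)+
  then show "\<exists>B. breaks (compose {0..1} f g) B" by blast
qed

lemma thompson_F_inverse:
  assumes f: "f \<in> thompson_F_set"
  shows "restrict (inv_into {0..1} f) {0..1} \<in> thompson_F_set"
  unfolding thompson_F_set_iff
proof (intro conjI)
  define h where "h = restrict (inv_into {0..1} f) {0..1}"
  have bij: "bij_betw f {0..1} {0..1}" by (rule thompson_F_bij_betw[OF f])
  have hI: "h y \<in> {0..1}" and fh: "f (h y) = y" if "y \<in> {0..1}" for y
    using that bij_betw_inv_into_right[OF bij that] bij_betwE[OF bij_betw_inv_into[OF bij]]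
    unfolding h_def by simp_all
  have hf: "h (f x) = x" if "x \<in> {0..1}" for x
    using that bij thompson_F_closed[OF f that] unfolding h_def by (simp add: bij_betw_inv_into_left)
  show "restrict (inv_into {0..1} f) {0..1} \<in> extensional {0..1}" by simp
  obtain g where g: "homeomorphism {0..1} {0..1} f g" using f by (auto simp: thompson_F_set_iff)
  have "h y = g y" if "y \<in> {0..1}" for y
  proof -
    have "g y \<in> {0..1}" using homeomorphism_image2[OF g] that by blast
    then show ?thesis using hf[of "g y"] homeomorphism_apply2[OF g that] by simp
  qed
  then have "homeomorphism {0..1} {0..1} h f"
    by (intro homeomorphism_cong[OF homeomorphism_symD[OF g]]) auto
  then show "\<exists>g. homeomorphism {0..1} {0..1} (restrict (inv_into {0..1} f) {0..1}) g"
    unfolding h_def by blast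
  obtain B where B: "breaks f B" using f by (auto simp: thompson_F_set_iff)
  have B01: "x \<in> {0..1}" "x \<in> {0<..<1}" "x \<in> dyadic_rationals" if "x \<in> B" for x
    using that B by (auto simp: breaks_def)
  have "breaks h (f ` B)"
    unfolding breaks_def
  proof (intro conjI allI impI)
    show "finite (f ` B)" using B by (simp add: breaks_def)
    show "f ` B \<subseteq> dyadic_rationals \<inter> {0<..<1}"
      using B01 thompson_F_dyadic[OF f] thompson_F_interior[OF f] by blast
    fix a b assume ab: "0 \<le> a \<and> a < b \<and> b \<le> 1 \<and> {a<..<b} \<inter> f ` B = {}"
    then have I: "a \<in> {0..1}" "b \<in> {0..1}" by auto
    have "h a < h b" using thompson_F_mono_iff[OF f hI hI, OF I] fh[OF I(1)] fh[OF I(2)] ab by simp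
    moreover have "{h a<..<h b} \<inter> B = {}"
    proof (rule ccontr)
      assume "{h a<..<h b} \<inter> B \<noteq> {}"
      then obtain x where x: "h a < x" "x < h b" "x \<in> B" by auto
      then have "a < f x" "f x < b"
        using thompson_F_mono_iff[OF f hI B01(1), OF I(1) x(3)]
          thompson_F_mono_iff[OF f B01(1) hI, OF x(3) I(2)] fh[OF I(1)] fh[OF I(2)] by auto
      then show False using x(3) ab by auto
    qed
    ultimately obtain k where
      k: "\<And>x. h a \<le> x \<Longrightarrow> x \<le> h b \<Longrightarrow> f x = f (h a) + 2 powi k * (x - h a)"
      using breaksE[OF B, of "h a" "h b"] hI[OF I(1)] hI[OF I(2)] by auto
    have "h y = h a + 2 powi (- k) * (y - a)" if y: "y \<in> {a..b}" for y
    proof -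
      have yI: "y \<in> {0..1}" using y ab by auto
      have "h a \<le> h y" "h y \<le> h b"
        using thompson_F_mono_iff[OF f hI hI, OF yI I(1)] thompson_F_mono_iff[OF f hI hI, OF I(2) yI]
          fh[OF I(1)] fh[OF I(2)] fh[OF yI] y by auto
      then have "y = a + 2 powi k * (h y - h a)" using k[of "h y"] fh[OF yI] fh[OF I(1)] by simp
      then have "y - a = 2 powi k * (h y - h a)" by simp
      then show ?thesis by (simp add: power_int_minus mult.assoc[symmetric])
    qed
    then show "\<exists>k. \<forall>x\<in>{a..b}. h x = h a + 2 powi k * (x - a)" by blast
  qed
  then show "\<exists>B. breaks (restrict (inv_into {0..1} f) {0..1}) B" unfolding h_def by blast
qed

lemma thompson_F_id: "(\<lambda>x\<in>{0..1}. x) \<in> thompson_F_set"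
  unfolding thompson_F_set_iff
proof (intro conjI)
  have "homeomorphism {0..1} {0..1} (\<lambda>x::real\<in>{0..1}. x) (\<lambda>x. x)"
    by (rule homeomorphism_cong[OF homeomorphism_ident]) auto
  then show "\<exists>g. homeomorphism {0..1} {0..1} (\<lambda>x::real\<in>{0..1}. x) g" by blast
  show "\<exists>B. breaks (\<lambda>x\<in>{0..1}. x) B"
    by (intro exI[of _ "{}"]) (auto simp: breaks_def intro!: exI[of _ 0])
qed simp

lemma thompson_F_Bij: "thompson_F_set \<subseteq> Bij {0..1}"
  using thompson_F_bij_betw by (auto simp: Bij_def thompson_F_set_iff)

lemma subgroup_thompson_F: "subgroup thompson_F_set (BijGroup {0..1})"
proof -
  interpret group "BijGroup {0..1::real}" by (rule group_BijGroup)
  have mult: "f \<otimes>\<^bsub>BijGroup {0..1}\<^esub> g = compose {0..1} f g"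
    if "f \<in> thompson_F_set" "g \<in> thompson_F_set" for f g
    using that thompson_F_Bij by (auto simp: BijGroup_def)
  show ?thesis
  proof (rule subgroupI)
    show "thompson_F_set \<subseteq> carrier (BijGroup {0..1})"
      using thompson_F_Bij by (simp add: BijGroup_def)
    show "thompson_F_set \<noteq> {}" using thompson_F_id by blast
    fix f assume f: "f \<in> thompson_F_set"
    let ?h = "restrict (inv_into {0..1} f) {0..1}"
    have h: "?h \<in> thompson_F_set" by (rule thompson_F_inverse[OF f])
    have "?h \<otimes>\<^bsub>BijGroup {0..1}\<^esub> f = \<one>\<^bsub>BijGroup {0..1}\<^esub>"
      using mult[OF h f] Bij_compose_restrict_eq[of f "{0..1}"] f thompson_F_Bij
      by (auto simp: BijGroup_def)
    then have "inv\<^bsub>BijGroup {0..1}\<^esub> f = ?h"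
      using f h thompson_F_Bij by (intro inv_equality) (auto simp: BijGroup_def)
    then show "inv\<^bsub>BijGroup {0..1}\<^esub> f \<in> thompson_F_set" using h by simp
    fix g assume "g \<in> thompson_F_set"
    then show "f \<otimes>\<^bsub>BijGroup {0..1}\<^esub> g \<in> thompson_F_set"
      using mult f thompson_F_compose by simp
  qed
qed

interpretation F: group thompson_F
  unfolding thompson_F_def by (rule subgroup.subgroup_is_group[OF subgroup_thompson_F group_BijGroup])

lemma carrier_F [simp]: "carrier thompson_F = thompson_F_set"
  by (simp add: thompson_F_def)

lemma F_mult_apply:
  assumes "f \<in> thompson_F_set" "g \<in> thompson_F_set" "x \<in> {0..1}"
  shows "(f \<otimes>\<^bsub>thompson_F\<^esub> g) x = f (g x)"
  using assms thompson_F_Bij by (auto simp: thompson_F_def BijGroup_def compose_def)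

lemma F_one_apply: "x \<in> {0..1} \<Longrightarrow> \<one>\<^bsub>thompson_F\<^esub> x = x"
  by (simp add: thompson_F_def BijGroup_def)

lemma F_inv_apply:
  assumes "f \<in> thompson_F_set" "x \<in> {0..1}"
  shows "(inv\<^bsub>thompson_F\<^esub> f) (f x) = x" "f ((inv\<^bsub>thompson_F\<^esub> f) x) = x"
  using F_mult_apply[of "inv\<^bsub>thompson_F\<^esub> f" f x] F_mult_apply[of f "inv\<^bsub>thompson_F\<^esub> f" x]
    F.l_inv[of f] F.r_inv[of f] F.inv_closed[of f] assms F_one_apply by simp_all

lemma F_ext:
  assumes "f \<in> thompson_F_set" "g \<in> thompson_F_set" "\<And>x. x \<in> {0..1} \<Longrightarrow> f x = g x"
  shows "f = g"
  using assms by (intro extensionalityI[of _ "{0..1}"]) (auto simp: thompson_F_set_iff)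

lemma F_gen_closed: "gen0 \<in> thompson_F_set" "gen1 \<in> thompson_F_set"
proof -
  \<comment> \<open>The generators and their inverses have all slopes at most 2, so one Lipschitz
    criterion gives the continuity of all four maps.\<close>
  have lip: "continuous_on {0..1} h" if "\<And>x y. x \<in> {0..1} \<Longrightarrow> y \<in> {0..1} \<Longrightarrow> x < y \<Longrightarrow> \<bar>h y - h x\<bar> \<le> 2 * (y - x)"
    for h :: "real \<Rightarrow> real"
  proof (rule lipschitz_on_continuous_on[of 2], rule lipschitz_onI)
    fix x y :: real assume "x \<in> {0..1}" "y \<in> {0..1}"
    then show "dist (h x) (h y) \<le> 2 * dist x y"
      using that[of x y] that[of y x] by (cases x y rule: linorder_cases) (auto simp: dist_real_def)
  qed simp
  let ?i0 = "\<lambda>t::real. if t \<le> 1/4 then 2 * t else if t \<le> 1/2 then t + 1/4 else t / 2 + 1 / 2"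
  let ?i1 = "\<lambda>t::real. if t \<le> 1/2 then t else if t \<le> 5/8 then 2 * t - 1/2
     else if t \<le> 3/4 then t + 1/8 else t / 2 + 1 / 2"
  have h0: "homeomorphism {0..1} {0..1} gen0 ?i0"
  proof (rule homeomorphismI)
    show "continuous_on {0..1} gen0" by (rule lip) (auto simp: gen0_def)
    show "continuous_on {0..1} ?i0" by (rule lip) auto
  qed (auto simp: gen0_def field_simps)
  have b: "breaks gen0 {1/2, 3/4}"
    unfolding breaks_def
  proof (intro conjI allI impI)
    have "1/2 \<in> dyadic_rationals" "3/4 \<in> dyadic_rationals"
      by (rule dyadicI[of _ 1 1], simp) (rule dyadicI[of _ 3 2], simp)
    then show "{1/2, 3/4} \<subseteq> dyadic_rationals \<inter> {0<..<1}" by auto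
    fix a b :: real assume ab: "0 \<le> a \<and> a < b \<and> b \<le> 1 \<and> {a<..<b} \<inter> {1/2, 3/4} = {}"
    then consider "b \<le> 1/2" | "1/2 \<le> a" "b \<le> 3/4" | "3/4 \<le> a" by fastforce
    then show "\<exists>k. \<forall>x\<in>{a..b}. gen0 x = gen0 a + 2 powi k * (x - a)"
    proof cases
      case 1
      then show ?thesis using ab by (intro exI[of _ "-1"]) (auto simp: gen0_def power_int_def field_simps)
    next
      case 2
      then show ?thesis using ab by (intro exI[of _ "0"]) (auto simp: gen0_def power_int_def field_simps)
    next
      case 3
      then show ?thesis using ab by (intro exI[of _ "1"]) (auto simp: gen0_def power_int_def field_simps)
    qed
  qed simp
  have "gen0 \<in> extensional {0..1}" by (simp add: gen0_def)
  then show "gen0 \<in> thompson_F_set"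
    unfolding thompson_F_set_iff using h0 b by blast
  have h1: "homeomorphism {0..1} {0..1} gen1 ?i1"
  proof (rule homeomorphismI)
    show "continuous_on {0..1} gen1" by (rule lip) (auto simp: gen1_def)
    show "continuous_on {0..1} ?i1" by (rule lip) auto
  qed (auto simp: gen1_def field_simps)
  have b: "breaks gen1 {1/2, 3/4, 7/8}"
    unfolding breaks_def
  proof (intro conjI allI impI)
    have "1/2 \<in> dyadic_rationals" "3/4 \<in> dyadic_rationals" "7/8 \<in> dyadic_rationals"
      by (rule dyadicI[of _ 1 1], simp) (rule dyadicI[of _ 3 2], simp, rule dyadicI[of _ 7 3], simp)
    then show "{1/2, 3/4, 7/8} \<subseteq> dyadic_rationals \<inter> {0<..<1}" by auto
    fix a b :: real assume ab: "0 \<le> a \<and> a < b \<and> b \<le> 1 \<and> {a<..<b} \<inter> {1/2, 3/4, 7/8} = {}"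
    then consider "b \<le> 1/2" | "1/2 \<le> a" "b \<le> 3/4" | "3/4 \<le> a" "b \<le> 7/8" | "7/8 \<le> a" by fastforce
    then show "\<exists>k. \<forall>x\<in>{a..b}. gen1 x = gen1 a + 2 powi k * (x - a)"
    proof cases
      case 1
      then show ?thesis using ab by (intro exI[of _ "0"]) (auto simp: gen1_def power_int_def field_simps)
    next
      case 2
      then show ?thesis using ab by (intro exI[of _ "-1"]) (auto simp: gen1_def power_int_def field_simps)
    next
      case 3
      then show ?thesis using ab by (intro exI[of _ "0"]) (auto simp: gen1_def power_int_def field_simps)
    next
      case 4
      then show ?thesis using ab by (intro exI[of _ "1"]) (auto simp: gen1_def power_int_def field_simps)
    qed
  qed simp
  have "gen1 \<in> extensional {0..1}" by (simp add: gen1_def)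
  then show "gen1 \<in> thompson_F_set"
    unfolding thompson_F_set_iff using h1 b by blast
qed

abbreviation F_mult :: "(real \<Rightarrow> real) \<Rightarrow> (real \<Rightarrow> real) \<Rightarrow> (real \<Rightarrow> real)" (infixl "\<odot>" 70) where
  "f \<odot> g \<equiv> f \<otimes>\<^bsub>thompson_F\<^esub> g"

abbreviation F_inv :: "(real \<Rightarrow> real) \<Rightarrow> (real \<Rightarrow> real)" where
  "F_inv f \<equiv> inv\<^bsub>thompson_F\<^esub> f"

lemma F_mult_closed: "f \<in> thompson_F_set \<Longrightarrow> g \<in> thompson_F_set \<Longrightarrow> f \<odot> g \<in> thompson_F_set"
  using F.m_closed by simp

lemma F_inv_closed: "f \<in> thompson_F_set \<Longrightarrow> F_inv f \<in> thompson_F_set"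
  using F.inv_closed by simp

lemma F_one_closed: "\<one>\<^bsub>thompson_F\<^esub> \<in> thompson_F_set"
  using F.one_closed by simp

lemma F_inv_fixed: "f \<in> thompson_F_set \<Longrightarrow> x \<in> {0..1} \<Longrightarrow> f x = x \<Longrightarrow> F_inv f x = x"
  using F_inv_apply(1)[of f x] by simp

lemma F_int_pow_closed: "f \<in> thompson_F_set \<Longrightarrow> f [^]\<^bsub>thompson_F\<^esub> (m :: int) \<in> thompson_F_set"
  using F.int_pow_closed by simp

lemma F_nat_pow_closed: "f \<in> thompson_F_set \<Longrightarrow> f [^]\<^bsub>thompson_F\<^esub> (m :: nat) \<in> thompson_F_set"
  using F.nat_pow_closed by simp

section \<open>One-sided slopes\<close>

text \<open>The side is encoded as \<open>s = 1\<close> (right) or \<open>s = - 1\<close> (left).\<close>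

definition germ :: "real \<Rightarrow> (real \<Rightarrow> real) \<Rightarrow> real \<Rightarrow> int \<Rightarrow> bool" where
  "germ s f x k \<longleftrightarrow> (\<exists>e>0. \<forall>h. 0 \<le> h \<and> h \<le> e \<longrightarrow> f (x + s * h) = f x + s * (2 powi k * h))"

lemma germI: "0 < e \<Longrightarrow> (\<And>h. 0 \<le> h \<Longrightarrow> h \<le> e \<Longrightarrow> f (x + s * h) = f x + s * (2 powi k * h)) \<Longrightarrow> germ s f x k"
  unfolding germ_def by blast

lemma germE:
  assumes "germ s f x k"
  obtains e where "0 < e" "\<And>h. 0 \<le> h \<Longrightarrow> h \<le> e \<Longrightarrow> f (x + s * h) = f x + s * (2 powi k * h)"
  using assms unfolding germ_def by blast

lemma germ_unique:
  assumes "germ s f x k" "germ s f x l" "s \<noteq> 0"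
  shows "k = l"
proof -
  obtain e where e: "0 < e" "\<And>h. 0 \<le> h \<Longrightarrow> h \<le> e \<Longrightarrow> f (x + s * h) = f x + s * (2 powi k * h)"
    using assms(1) by (rule germE) blast
  obtain d where d: "0 < d" "\<And>h. 0 \<le> h \<Longrightarrow> h \<le> d \<Longrightarrow> f (x + s * h) = f x + s * (2 powi l * h)"
    using assms(2) by (rule germE) blast
  define h where "h = min e d"
  have h: "0 < h" "h \<le> e" "h \<le> d" using e(1) d(1) by (simp_all add: h_def)
  have "f x + s * (2 powi k * h) = f x + s * (2 powi l * h)"
    using e(2)[of h] d(2)[of h] h by linarith
  then have eq: "(2::real) powi k = 2 powi l" using h(1) assms(3) by simp
  show ?thesis
  proof (rule linorder_cases[of k l])
    assume "k < l"
    then show ?thesis using eq power_int_strict_increasing[of k l "2::real"] by simp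
  next
    assume "l < k"
    then show ?thesis using eq power_int_strict_increasing[of l k "2::real"] by simp
  qed
qed

lemma germ_cong:
  assumes "germ s f x k" "\<bar>s\<bar> = 1" "0 < d" "\<And>t. \<bar>t - x\<bar> \<le> d \<Longrightarrow> f t = g t"
  shows "germ s g x k"
proof -
  obtain e where e: "0 < e" "\<And>h. 0 \<le> h \<Longrightarrow> h \<le> e \<Longrightarrow> f (x + s * h) = f x + s * (2 powi k * h)"
    using assms(1) by (rule germE) blast
  show ?thesis
  proof (rule germI[of "min e d"])
    fix h assume h: "0 \<le> h" "h \<le> min e d"
    then have "f (x + s * h) = g (x + s * h)"
      using assms(2) by (intro assms(4)) (simp add: abs_mult)
    then show "g (x + s * h) = g x + s * (2 powi k * h)"
      using e(2)[of h] h assms(3) assms(4)[of x] by simp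
  qed (use e assms in simp)
qed

lemma germ_comp:
  assumes "germ s g x k" "germ s f (g x) l"
  shows "germ s (\<lambda>t. f (g t)) x (k + l)"
proof -
  obtain e where e: "0 < e" "\<And>h. 0 \<le> h \<Longrightarrow> h \<le> e \<Longrightarrow> g (x + s * h) = g x + s * (2 powi k * h)"
    using assms(1) by (rule germE) blast
  obtain d where d: "0 < d" "\<And>h. 0 \<le> h \<Longrightarrow> h \<le> d \<Longrightarrow> f (g x + s * h) = f (g x) + s * (2 powi l * h)"
    using assms(2) by (rule germE) blast
  \<comment> \<open>Near \<open>x\<close> the map \<open>g\<close> scales lengths by
    \<open>2 powi k\<close>, so the radius \<open>d\<close> on which \<open>f\<close> is linear is
    divided by that factor.\<close>
  show ?thesis
  proof (rule germI[of "min e (d / 2 powi k)"])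
    fix h assume h: "0 \<le> h" "h \<le> min e (d / 2 powi k)"
    then have "2 powi k * h \<le> d" by (simp add: pos_le_divide_eq mult.commute)
    then show "f (g (x + s * h)) = f (g x) + s * (2 powi (k + l) * h)"
      using e(2)[of h] d(2)[of "2 powi k * h"] h by (simp add: power_int_add mult_ac)
  qed (use e(1) d(1) in simp)
qed

lemma germ_exists:
  assumes "f \<in> thompson_F_set" "0 < x" "x < 1" "\<bar>s\<bar> = 1"
  shows "\<exists>k. germ s f x k"
proof -
  obtain B where B: "breaks f B" using assms(1) by (auto simp: thompson_F_set_iff)
  \<comment> \<open>The radius keeps away from both ends of the unit interval and from all
    breakpoints other than \<open>x\<close>. The point \<open>x\<close> may itself be a breakpoint,
    hence the two sides are treated separately.\<close>
  then have "finite (insert 0 (insert 1 B))" using breaks_finite by simp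
  from finite_set_avoid[OF this, of x] obtain d where d: "d > 0"
    "\<And>b. b \<in> insert 0 (insert 1 B) \<Longrightarrow> b \<noteq> x \<Longrightarrow> d \<le> dist x b" by blast
  have d01: "d \<le> x" "d \<le> 1 - x" using d(2)[of 0] d(2)[of 1] assms(2,3) by (auto simp: dist_real_def)
  have B': "d \<le> \<bar>x - b\<bar>" if "b \<in> B" "b \<noteq> x" for b
    using d(2)[of b] that by (simp add: dist_real_def)
  consider "s = 1" | "s = -1" using assms(4) by linarith
  then show ?thesis
  proof cases
    case 1
    have p: "0 \<le> x" "x < x + d" "x + d \<le> 1" using assms d d01 by auto
    have "{x<..<x+d} \<inter> B = {}" using B' by force
    then obtain k :: int where k: "\<And>t. x \<le> t \<Longrightarrow> t \<le> x + d \<Longrightarrow> f t = f x + 2 powi k * (t - x)"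
      by (rule breaksE[OF B p]) blast
    have "germ s f x k"
    proof (rule germI[of d])
      fix h assume "0 \<le> h" "h \<le> d"
      then show "f (x + s * h) = f x + s * (2 powi k * h)" using k[of "x + h"] 1 by simp
    qed (rule d(1))
    then show ?thesis ..
  next
    case 2
    have p: "0 \<le> x - d" "x - d < x" "x \<le> 1" using assms d d01 by auto
    have "{x-d<..<x} \<inter> B = {}" using B' by force
    then obtain k :: int where k: "\<And>t. x - d \<le> t \<Longrightarrow> t \<le> x \<Longrightarrow> f t = f (x - d) + 2 powi k * (t - (x - d))"
      by (rule breaksE[OF B p]) blast
    have "germ s f x k"
    proof (rule germI[of d])
      fix h assume "0 \<le> h" "h \<le> d"
      then show "f (x + s * h) = f x + s * (2 powi k * h)"
        using k[of "x - h"] k[of x] 2 d(1) by (simp add: algebra_simps)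
    qed (rule d(1))
    then show ?thesis ..
  qed
qed

text \<open>This is the binary logarithm of the one-sided derivative, so that products of slopes
  become sums.\<close>

definition slope :: "real \<Rightarrow> (real \<Rightarrow> real) \<Rightarrow> real \<Rightarrow> int" where
  "slope s f x = (THE k. germ s f x k)"

lemma slope_eqI: "germ s f x k \<Longrightarrow> \<bar>s\<bar> = 1 \<Longrightarrow> slope s f x = k"
  unfolding slope_def by (rule the_equality) (auto intro: germ_unique)

lemma germ_slope:
  assumes "f \<in> thompson_F_set" "0 < x" "x < 1" "\<bar>s\<bar> = 1"
  shows "germ s f x (slope s f x)"
proof -
  obtain k where k: "germ s f x k" using germ_exists[OF assms] by blast
  then show ?thesis using slope_eqI[OF k assms(4)] by simp
qed

text \<open>The chain rule in logarithmic form. The side \<open>s\<close> is the same for both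
  factors because the slopes are positive; at a fixed point of \<open>g\<close> the formula is
  additive.\<close>

lemma slope_mult:
  assumes "f \<in> thompson_F_set" "g \<in> thompson_F_set" "0 < x" "x < 1" "\<bar>s\<bar> = 1"
  shows "slope s (f \<odot> g) x = slope s g x + slope s f (g x)"
proof (rule slope_eqI)
  have "0 < g x" "g x < 1" using thompson_F_interior[OF assms(2), of x] assms(3,4) by auto
  then have "germ s (\<lambda>t. f (g t)) x (slope s g x + slope s f (g x))"
    using assms by (intro germ_comp germ_slope)
  then show "germ s (f \<odot> g) x (slope s g x + slope s f (g x))"
  proof (rule germ_cong)
    fix t assume "\<bar>t - x\<bar> \<le> min x (1 - x)"
    then have "t \<in> {0..1}" by auto
    then show "f (g t) = (f \<odot> g) t" using F_mult_apply[OF assms(1,2)] by simp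
  qed (use assms in auto)
qed (rule assms(5))

lemma slope_id_near:
  assumes "0 < e" "\<And>h. 0 \<le> h \<Longrightarrow> h \<le> e \<Longrightarrow> f (x + s * h) = x + s * h" "\<bar>s\<bar> = 1"
  shows "slope s f x = 0"
proof (rule slope_eqI)
  show "germ s f x 0"
    by (rule germI[OF assms(1)]) (use assms(1) assms(2)[of 0] in \<open>simp add: assms(2)\<close>)
qed (rule assms(3))

lemma slope_one:
  assumes "0 < x" "x < 1" "\<bar>s\<bar> = 1"
  shows "slope s \<one>\<^bsub>thompson_F\<^esub> x = 0"
proof (rule slope_id_near[of "min x (1 - x)"])
  fix h assume h: "0 \<le> h" "h \<le> min x (1 - x)"
  consider "s = 1" | "s = -1" using assms(3) by linarith
  then have "x + s * h \<in> {0..1}" using h assms by cases auto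
  then show "\<one>\<^bsub>thompson_F\<^esub> (x + s * h) = x + s * h" by (rule F_one_apply)
qed (use assms in auto)

lemma slope_inv:
  assumes "f \<in> thompson_F_set" "0 < x" "x < 1" "\<bar>s\<bar> = 1"
  shows "slope s (F_inv f) (f x) = - slope s f x"
proof -
  have "slope s (F_inv f \<odot> f) x = slope s f x + slope s (F_inv f) (f x)"
    using assms by (intro slope_mult F_inv_closed)
  moreover have "F_inv f \<odot> f = \<one>\<^bsub>thompson_F\<^esub>" using assms(1) by simp
  ultimately show ?thesis using slope_one[OF assms(2-4)] by simp
qed

lemma nat_pow_fixed:
  assumes "f \<in> thompson_F_set" "0 \<le> x" "x \<le> 1" "f x = x"
  shows "(f [^]\<^bsub>thompson_F\<^esub> (n :: nat)) x = x"
  by (induction n) (use assms in \<open>simp_all add: F_one_apply F_mult_apply F_nat_pow_closed\<close>)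

lemma int_pow_fixed:
  assumes "f \<in> thompson_F_set" "0 \<le> x" "x \<le> 1" "f x = x"
  shows "(f [^]\<^bsub>thompson_F\<^esub> (m :: int)) x = x"
proof (cases m rule: int_cases2)
  case (nonneg n)
  then show ?thesis using nat_pow_fixed[OF assms] by (simp add: int_pow_int)
next
  case (nonpos n)
  then show ?thesis
    using F_inv_fixed[OF F_nat_pow_closed, of f x n] nat_pow_fixed[OF assms] assms
    by (simp add: F.int_pow_neg_int)
qed

lemma slope_nat_pow:
  assumes "f \<in> thompson_F_set" "0 < x" "x < 1" "f x = x" "\<bar>s\<bar> = 1"
  shows "slope s (f [^]\<^bsub>thompson_F\<^esub> (n :: nat)) x = int n * slope s f x"
proof (induction n)
  case (Suc n)
  have "slope s (f [^]\<^bsub>thompson_F\<^esub> n \<odot> f) x = slope s f x + slope s (f [^]\<^bsub>thompson_F\<^esub> n) (f x)"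
    using assms by (intro slope_mult F_nat_pow_closed)
  then show ?case using Suc assms(4) by (simp add: algebra_simps)
qed (use assms slope_one in simp)

lemma slope_int_pow:
  assumes "f \<in> thompson_F_set" "0 < x" "x < 1" "f x = x" "\<bar>s\<bar> = 1"
  shows "slope s (f [^]\<^bsub>thompson_F\<^esub> (m :: int)) x = m * slope s f x"
proof (cases m rule: int_cases2)
  case (nonneg n)
  then show ?thesis using slope_nat_pow[OF assms] by (simp add: int_pow_int)
next
  case (nonpos n)
  then show ?thesis
    using slope_inv[OF F_nat_pow_closed[OF assms(1)] assms(2,3,5), of n] nat_pow_fixed[of f x n]
      slope_nat_pow[OF assms] assms
    by (simp add: F.int_pow_neg_int)
qed

section \<open>Bumps and their centralizers\<close>

text \<open>The slopes are taken at the ends of the interval from inside, so on an interval of the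
  partition a bump has the value \<open>k + l\<close>.\<close>

definition bump :: "(real \<Rightarrow> real) \<Rightarrow> real \<Rightarrow> real \<Rightarrow> int \<Rightarrow> int \<Rightarrow> bool" where
  "bump f a b k l \<longleftrightarrow> f \<in> thompson_F_set \<and> 0 < a \<and> a < b \<and> b < 1 \<and>
     (\<forall>t. 0 \<le> t \<and> t \<le> a \<or> b \<le> t \<and> t \<le> 1 \<longrightarrow> f t = t) \<and> slope 1 f a = k \<and> slope (-1) f b = l"

definition contracts :: "(real \<Rightarrow> real) \<Rightarrow> real \<Rightarrow> real \<Rightarrow> bool" where
  "contracts f a b \<longleftrightarrow> (\<forall>t. a < t \<and> t < b \<longrightarrow> f t < t)"

text \<open>End slopes at fixed points are invariant under conjugation: in the chain rule the
  contributions of \<open>c\<close> and of its inverse cancel.\<close>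

lemma bump_conj:
  assumes f: "bump f a b k l" and c: "c \<in> thompson_F_set"
  shows "bump (c \<odot> f \<odot> F_inv c) (c a) (c b) k l"
proof -
  have F: "f \<in> thompson_F_set" and ab: "0 < a" "a < b" "b < 1" "a < 1" "0 < b"
    and fix1: "\<And>t. 0 \<le> t \<Longrightarrow> t \<le> a \<Longrightarrow> f t = t" and fix2: "\<And>t. b \<le> t \<Longrightarrow> t \<le> 1 \<Longrightarrow> f t = t"
    and sl: "slope 1 f a = k" "slope (-1) f b = l"
    using f by (auto simp: bump_def)
  have ci: "F_inv c \<in> thompson_F_set" and cf: "c \<odot> f \<in> thompson_F_set"
    using F c by (auto intro: F_mult_closed F_inv_closed)
  have app: "(c \<odot> f \<odot> F_inv c) t = c (f (F_inv c t))" if "t \<in> {0..1}" for t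
    using that thompson_F_closed[OF ci that] by (simp add: F_mult_apply cf c F ci)
  have cc: "F_inv c (c t) = t" "c (F_inv c t) = t" if "0 \<le> t" "t \<le> 1" for t
    using F_inv_apply[OF c] that by auto
  have ca: "0 < c a" "c a < c b" "c b < 1" "0 < c b" "c a < 1"
    using thompson_F_interior[OF c, of a] thompson_F_interior[OF c, of b]
      thompson_F_strict_mono[OF c, of a b] ab by auto
  have "(c \<odot> f \<odot> F_inv c) t = t" if t: "0 \<le> t \<and> t \<le> c a \<or> c b \<le> t \<and> t \<le> 1" for t
  proof -
    have tI: "t \<in> {0..1}" using t ca by auto
    have ciI: "F_inv c t \<in> {0..1}" by (rule thompson_F_closed[OF ci tI])
    have "\<not> a < F_inv c t \<or> \<not> F_inv c t < b"
    proof (rule ccontr)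
      assume "\<not> ?thesis"
      then have "c a < c (F_inv c t)" "c (F_inv c t) < c b"
        using thompson_F_strict_mono[OF c, of a "F_inv c t"] thompson_F_strict_mono[OF c, of "F_inv c t" b]
          ab ciI by auto
      then show False using t cc(2)[of t] tI by auto
    qed
    then have "f (F_inv c t) = F_inv c t" using fix1[of "F_inv c t"] fix2[of "F_inv c t"] ciI by force
    then show ?thesis using app[OF tI] cc(2)[of t] tI by simp
  qed
  moreover have "slope s (c \<odot> f \<odot> F_inv c) (c x) = slope s f x"
    if "f x = x" "0 < x" "x < 1" "\<bar>s\<bar> = 1" for s x
  proof -
    have "0 < c x" "c x < 1" using thompson_F_interior[OF c, of x] that by auto
    then have "slope s (c \<odot> f \<odot> F_inv c) (c x) = slope s (F_inv c) (c x) + slope s (c \<odot> f) (F_inv c (c x))"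
      using that by (intro slope_mult cf ci)
    also have "F_inv c (c x) = x" using that by (simp add: cc)
    also have "slope s (c \<odot> f) x = slope s f x + slope s c (f x)"
      using that by (intro slope_mult c F)
    also have "slope s (F_inv c) (c x) = - slope s c x" using that by (intro slope_inv c)
    finally show ?thesis using that by simp
  qed
  ultimately show ?thesis
    unfolding bump_def using ca cf ci sl fix1[of a] fix2[of b] ab by (auto intro: F_mult_closed)
qed

lemma contracts_conj:
  assumes f: "f \<in> thompson_F_set" "0 \<le> a" "b \<le> 1" "a < b" "contracts f a b" and c: "c \<in> thompson_F_set"
  shows "contracts (c \<odot> f \<odot> F_inv c) (c a) (c b)"
  unfolding contracts_def
proof (intro allI impI)
  fix t assume t: "c a < t \<and> t < c b"
  have ci: "F_inv c \<in> thompson_F_set" and cf: "c \<odot> f \<in> thompson_F_set"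
    using f(1) c by (auto intro: F_mult_closed F_inv_closed)
  have I: "a \<in> {0..1}" "b \<in> {0..1}" using f(2-4) by auto
  have tI: "t \<in> {0..1}" using t thompson_F_closed[OF c I(1)] thompson_F_closed[OF c I(2)] by auto
  let ?u = "F_inv c t"
  have uI: "?u \<in> {0..1}" by (rule thompson_F_closed[OF ci tI])
  have cu: "c ?u = t" using F_inv_apply[OF c tI] by simp
  have "a < ?u" "?u < b"
    using thompson_F_mono_iff[OF c I(1) uI] thompson_F_mono_iff[OF c uI I(2)] cu t by auto
  then have "f ?u < ?u" using f(5) by (simp add: contracts_def)
  then have "c (f ?u) < c ?u"
    using thompson_F_mono_iff[OF c thompson_F_closed[OF f(1) uI] uI] by simp
  then show "(c \<odot> f \<odot> F_inv c) t < t"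
    using cu F_mult_apply[OF cf ci tI] F_mult_apply[OF c f(1) uI] by simp
qed

text \<open>Between \<open>b\<close> and \<open>c\<close> the map is the identity, so the left slope
  at \<open>c\<close> is trivial. In this way a bump with opposite end slopes becomes one whose end
  slopes no longer cancel.\<close>

lemma bump_weaken:
  assumes "bump f a b k l" "b < c" "c < 1"
  shows "bump f a c k 0"
proof -
  have "slope (-1) f c = 0"
    using assms by (intro slope_id_near[of "c - b"]) (auto simp: bump_def)
  then show ?thesis using assms by (auto simp: bump_def)
qed

text \<open>If \<open>v\<close> is the identity up to \<open>T\<close> and \<open>f r < T\<close>,
  then \<open>f (v r) = v (f r) = f r\<close>, and injectivity of \<open>f\<close> gives
  \<open>v r = r\<close>. As \<open>f\<close> moves points towards \<open>a\<close>, this reaches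
  beyond every \<open>T < b\<close>, so the supremum of the good points is \<open>b\<close>.\<close>

lemma contracts_commute_id:
  assumes f: "f \<in> thompson_F_set" "contracts f a b" "f a = a" "f b = b" "0 < a" "a < b" "b < 1"
    and v: "v \<in> thompson_F_set" "v \<odot> f = f \<odot> v"
    and near: "0 < e" "\<And>t. a \<le> t \<Longrightarrow> t \<le> a + e \<Longrightarrow> v t = t"
    and t: "a \<le> t" "t < b"
  shows "v t = t"
proof -
  define S where "S = {t. a \<le> t \<and> t < b \<and> (\<forall>r. a \<le> r \<and> r \<le> t \<longrightarrow> v r = r)}"
  have bdd: "bdd_above S" by (rule bdd_aboveI[of _ b]) (auto simp: S_def)
  have "a \<in> S" using near f(6) by (auto simp: S_def)
  define T where "T = Sup S"
  have ub: "r \<le> T" if "r \<in> S" for r using that bdd unfolding T_def by (rule cSup_upper)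
  have aT: "a \<le> T" by (rule ub) fact
  have Tb: "T \<le> b" unfolding T_def using \<open>a \<in> S\<close> by (intro cSup_least) (auto simp: S_def)
  have "a + min e ((b - a) / 2) \<in> S"
    using near(1) f(6) by (auto simp: S_def min_def field_simps intro!: near(2))
  then have "a + min e ((b - a) / 2) \<le> T" by (rule ub)
  moreover have "0 < min e ((b - a) / 2)" using near(1) f(6) by simp
  ultimately have "a < T" by linarith
  have below: "v r = r" if r: "a \<le> r" "r < T" for r
  proof -
    obtain q where "q \<in> S" "r < q"
      using r(2) less_cSupE[of r S] \<open>a \<in> S\<close> unfolding T_def by blast
    then show ?thesis using r by (auto simp: S_def)
  qed
  have "T = b"
  proof (rule ccontr)
    assume "T \<noteq> b"
    then have "T < b" using Tb by simp
    have TI: "T \<in> {0..1}" using aT Tb f by auto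
    obtain w where w: "w \<in> {0..1}" "f w = T" using thompson_F_surj[OF f(1) TI] by blast
    have "a < w" using thompson_F_mono_iff[OF f(1) _ w(1), of a] f w \<open>a < T\<close> by auto
    moreover have "w < b" using thompson_F_mono_iff[OF f(1) w(1), of b] f w \<open>T < b\<close> by auto
    ultimately have "T < w" using f(2) w(2) by (auto simp: contracts_def)
    \<comment> \<open>\<open>f\<close> maps \<open>[a, q]\<close> into \<open>[a, T)\<close>, where
      \<open>v\<close> is already known to be the identity, because \<open>q\<close> lies below the
      preimage \<open>w\<close> of \<open>T\<close>.\<close>
    define q where "q = (T + w) / 2"
    have q: "T < q" "q < w" using \<open>T < w\<close> by (auto simp: q_def)
    have "v r = r" if r: "a \<le> r" "r \<le> q" for r
    proof -
      have rI: "r \<in> {0..1}" using r q \<open>w < b\<close> f by auto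
      have aI: "a \<in> {0..1}" using f by auto
      have "a \<le> f r" using thompson_F_mono_iff[OF f(1) rI aI] f(3) r by auto
      moreover have "f r < T" using thompson_F_mono_iff[OF f(1) rI w(1)] w(2) r q by auto
      ultimately have "v (f r) = f r" by (rule below)
      moreover have "v (f r) = f (v r)"
        using F_mult_apply[OF v(1) f(1) rI] F_mult_apply[OF f(1) v(1) rI] v(2) by simp
      ultimately have "f (v r) = f r" by simp
      then show ?thesis
        using thompson_F_mono_iff[OF f(1) rI thompson_F_closed[OF v(1) rI]]
          thompson_F_mono_iff[OF f(1) thompson_F_closed[OF v(1) rI] rI] by auto
    qed
    then have "q \<in> S" using q \<open>w < b\<close> aT by (auto simp: S_def)
    then show False using ub q(1) by fastforce
  qed
  then show ?thesis using below t by simp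
qed

text \<open>Near \<open>a\<close> an element \<open>u\<close> commuting with the contraction \<open>f\<close> agrees with a power of \<open>f\<close>, and
  conjugation by \<open>f\<close> propagates this to the whole interval.\<close>

lemma bump_centralizer:
  assumes f: "bump f a b (-1) 1" "contracts f a b"
    and u: "u \<in> thompson_F_set" "u \<odot> f = f \<odot> u" "u a = a" "u b = b"
  shows "slope 1 u a + slope (-1) u b = 0"
proof -
  have F: "f \<in> thompson_F_set" and ab: "0 < a" "a < b" "b < 1" "a < 1" "0 < b" and fa: "f a = a" and fb: "f b = b"
    and sl: "slope 1 f a = -1" "slope (-1) f b = 1"
    using f by (auto simp: bump_def)
  \<comment> \<open>The logarithm of the slope of \<open>f\<close> at \<open>a\<close> is
    \<open>-1\<close>, so the \<open>m\<close>-th power of \<open>f\<close> has \<open>-m\<close>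
    there and cancels the slope of \<open>u\<close>. At \<open>b\<close> the same power contributes
    \<open>m\<close>, which becomes the opposite slope of \<open>u\<close> once the product is known
    to be the identity.\<close>
  define m where "m = slope 1 u a"
  define g where "g = f [^]\<^bsub>thompson_F\<^esub> m"
  have g: "g \<in> thompson_F_set" unfolding g_def by (rule F_int_pow_closed[OF F])
  have ga: "g a = a" and gb: "g b = b" unfolding g_def using int_pow_fixed[OF F] ab fa fb by auto
  have gsl: "slope 1 g a = - m" "slope (-1) g b = m"
    unfolding g_def using slope_int_pow[OF F] ab fa fb sl by auto
  have gf: "g \<odot> f = f \<odot> g"
  proof -
    have "f [^]\<^bsub>thompson_F\<^esub> m \<odot> f [^]\<^bsub>thompson_F\<^esub> (1::int) = f [^]\<^bsub>thompson_F\<^esub> (1::int) \<odot> f [^]\<^bsub>thompson_F\<^esub> m"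
      using F.int_pow_mult[of f m 1] F.int_pow_mult[of f 1 m] F by (simp add: add.commute)
    then show ?thesis unfolding g_def using F.int_pow_1[of f] F by simp
  qed
  define v where "v = u \<odot> g"
  have v: "v \<in> thompson_F_set" unfolding v_def by (rule F_mult_closed[OF u(1) g])
  have vf: "v \<odot> f = f \<odot> v"
  proof -
    have "u \<odot> g \<odot> f = u \<odot> (f \<odot> g)" using F.m_assoc[of u g f] u(1) g F gf by simp
    also have "\<dots> = f \<odot> u \<odot> g" using F.m_assoc[of u f g] u(1,2) g F by simp
    also have "\<dots> = f \<odot> (u \<odot> g)" using F.m_assoc[of f u g] u(1) g F by simp
    finally show ?thesis unfolding v_def .
  qed
  have va: "v a = a" and vb: "v b = b"
    unfolding v_def using F_mult_apply[OF u(1) g] ab ga gb u(3,4) by auto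
  have "slope 1 v a = 0"
    unfolding v_def using slope_mult[OF u(1) g, of a 1] ab ga gsl(1) m_def by simp
  then have "germ 1 v a 0" using germ_slope[OF v, of a 1] ab by simp
  then obtain e where e: "0 < e" "\<And>h. 0 \<le> h \<Longrightarrow> h \<le> e \<Longrightarrow> v (a + 1 * h) = v a + 1 * (2 powi 0 * h)"
    by (rule germE) blast
  have near: "v t = t" if "a \<le> t" "t \<le> a + e" for t
    using e(2)[of "t - a"] that va by simp
  have vid: "v t = t" if "a \<le> t" "t < b" for t
    by (rule contracts_commute_id[OF F f(2) fa fb ab(1-3) v vf e(1) near that])
  have "slope (-1) v b = 0"
  proof (rule slope_id_near[of "b - a"])
    fix h assume "0 \<le> h" "h \<le> b - a"
    then show "v (b + (-1) * h) = b + (-1) * h" using vid[of "b - h"] vb by (cases "h = 0") auto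
  qed (use ab in auto)
  then have "slope (-1) u b = - m"
    unfolding v_def using slope_mult[OF u(1) g, of b "-1"] ab gb gsl(2) by simp
  then show ?thesis by (simp add: m_def)
qed

text \<open>The point \<open>b\<close> separates the supports and is fixed by both maps, so each map
  keeps the two sides of \<open>b\<close>.\<close>

lemma bump_commute:
  assumes f: "bump f a b k l" and g: "bump g c d i j" and "b \<le> c"
  shows "f \<odot> g = g \<odot> f"
proof (rule F_ext)
  have F: "f \<in> thompson_F_set" "g \<in> thompson_F_set" using f g by (auto simp: bump_def)
  show "f \<odot> g \<in> thompson_F_set" "g \<odot> f \<in> thompson_F_set" using F by (auto intro: F_mult_closed)
  fix t :: real assume t: "t \<in> {0..1}"
  have b: "b \<in> {0..1}" "f b = b" "g b = b" using assms by (auto simp: bump_def)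
  have "f (g t) = g (f t)"
  proof (cases "t \<le> b")
    case True
    then have "f t \<le> b" using thompson_F_mono_iff[OF F(1) b(1) t] b(2) by auto
    then show ?thesis
      using True assms t thompson_F_closed[OF F(1) t] by (simp add: bump_def)
  next
    case False
    then have "b \<le> g t" using thompson_F_mono_iff[OF F(2) t b(1)] b(3) by auto
    then show ?thesis
      using False assms t thompson_F_closed[OF F(2) t] by (simp add: bump_def)
  qed
  then show "(f \<odot> g) t = (g \<odot> f) t" using F_mult_apply F t by simp
qed

section \<open>The subgroups\<close>

text \<open>The points follow an orbit of \<open>gen0\<close> and accumulate only at
  \<open>0\<close>. Hence powers of \<open>gen0\<close> transport one model bump to all intervals,
  and linearity near \<open>0\<close> leaves finitely many conditions to test for a given
  element.\<close>

definition pt :: "nat \<Rightarrow> real" where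
  "pt n = (1/2) ^ Suc n"

lemma pt_bounds: "0 < pt n" "pt n < 1" "pt n \<in> {0..1}"
  unfolding pt_def using power_Suc_less_one[of "1/2::real" n] by (auto intro: less_imp_le)

lemma pt_strict_antimono: "m < n \<Longrightarrow> pt n < pt m"
  unfolding pt_def by (rule power_strict_decreasing) auto

lemma pt_antimono: "m \<le> n \<Longrightarrow> pt n \<le> pt m"
  unfolding pt_def by (rule power_decreasing) auto

definition stab :: "(real \<Rightarrow> real) set" where
  "stab = {f \<in> thompson_F_set. \<forall>n. f (pt n) = pt n}"

definition val :: "nat \<Rightarrow> (real \<Rightarrow> real) \<Rightarrow> int" where
  "val n f = slope 1 f (pt (Suc n)) + slope (-1) f (pt n)"

lemma stab_mult: "f \<in> stab \<Longrightarrow> g \<in> stab \<Longrightarrow> f \<odot> g \<in> stab"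
  unfolding stab_def using pt_bounds by (auto intro: F_mult_closed simp: F_mult_apply)

lemma stab_inv: "f \<in> stab \<Longrightarrow> F_inv f \<in> stab"
  unfolding stab_def using pt_bounds by (auto intro!: F_inv_closed F_inv_fixed)

lemma stab_one: "\<one>\<^bsub>thompson_F\<^esub> \<in> stab"
  unfolding stab_def using pt_bounds F_one_closed by (auto simp: F_one_apply)

lemma stab_nat_pow: "f \<in> stab \<Longrightarrow> f [^]\<^bsub>thompson_F\<^esub> (n :: nat) \<in> stab"
  by (induction n) (auto simp: stab_one stab_mult)

lemma val_mult: "f \<in> stab \<Longrightarrow> g \<in> stab \<Longrightarrow> val n (f \<odot> g) = val n f + val n g"
  unfolding val_def stab_def by (simp add: slope_mult pt_bounds)

lemma val_one: "val n \<one>\<^bsub>thompson_F\<^esub> = 0"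
  unfolding val_def by (simp add: slope_one pt_bounds)

lemma val_inv: "f \<in> stab \<Longrightarrow> val n (F_inv f) = - val n f"
  using val_mult[of f "F_inv f" n] val_one[of n] stab_inv[of f] by (simp add: stab_def)

lemma val_nat_pow: "f \<in> stab \<Longrightarrow> val n (f [^]\<^bsub>thompson_F\<^esub> (j :: nat)) = int j * val n f"
  by (induction j) (auto simp: val_one val_mult stab_nat_pow algebra_simps)

definition coded_subgroup :: "(nat \<Rightarrow> nat) \<Rightarrow> (real \<Rightarrow> real) set" where
  "coded_subgroup \<tau> = {f \<in> stab. \<forall>n. val (2 * n + 1) f = int (\<tau> n) * val (2 * n) f \<and>
     (\<tau> n = 0 \<longrightarrow> val (2 * n) f = 0)}"

text \<open>For fixed \<open>\<tau>\<close> all conditions are homogeneous linear equations in the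
  homomorphisms \<open>val n\<close> on \<open>stab\<close>.\<close>

lemma subgroup_coded: "subgroup (coded_subgroup \<tau>) thompson_F"
proof (rule F.subgroupI)
  show "coded_subgroup \<tau> \<subseteq> carrier thompson_F" by (auto simp: coded_subgroup_def stab_def)
  show "coded_subgroup \<tau> \<noteq> {}"
    using stab_one val_one by (auto simp: coded_subgroup_def)
  show "F_inv f \<in> coded_subgroup \<tau>" if "f \<in> coded_subgroup \<tau>" for f
    using that by (auto simp: coded_subgroup_def stab_inv val_inv)
  show "f \<odot> g \<in> coded_subgroup \<tau>" if "f \<in> coded_subgroup \<tau>" "g \<in> coded_subgroup \<tau>" for f g
    using that by (auto simp: coded_subgroup_def stab_mult val_mult algebra_simps)
qed

lemma bump_stab:
  assumes "bump f (pt (Suc n)) (pt n) k l"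
  shows "f \<in> stab"
proof -
  have "f (pt m) = pt m" for m
  proof (cases "m \<le> n")
    case True
    then show ?thesis using assms pt_antimono[of m n] pt_bounds[of m] by (simp add: bump_def)
  next
    case False
    then show ?thesis using assms pt_antimono[of "Suc n" m] pt_bounds[of m] by (simp add: bump_def)
  qed
  then show ?thesis using assms by (simp add: stab_def bump_def)
qed

lemma bump_val:
  assumes "bump f (pt (Suc n)) (pt n) k l"
  shows "val m f = (if m = n then k + l else 0)"
proof -
  have fix1: "f t = t" if "0 \<le> t" "t \<le> pt (Suc n)" for t using assms that by (simp add: bump_def)
  have fix2: "f t = t" if "pt n \<le> t" "t \<le> 1" for t using assms that by (simp add: bump_def)
  consider "m = n" | "m < n" | "n < m" by linarith
  then show ?thesis
  proof cases
    case 1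
    then show ?thesis using assms by (simp add: val_def bump_def)
  next
    case 2
    then have p: "pt n \<le> pt (Suc m)" "pt (Suc m) < pt m"
      using pt_antimono[of "Suc m" n] pt_strict_antimono[of m "Suc m"] by auto
    have "slope 1 f (pt (Suc m)) = 0"
      using p pt_bounds[of "Suc m"] by (intro slope_id_near[of "1 - pt (Suc m)"]) (auto intro!: fix2)
    moreover have "slope (-1) f (pt m) = 0"
      using p pt_bounds[of m] by (intro slope_id_near[of "pt m - pt n"]) (auto intro!: fix2)
    ultimately show ?thesis using 2 by (simp add: val_def)
  next
    case 3
    then have p: "pt m \<le> pt (Suc n)" "pt (Suc m) < pt m"
      using pt_antimono[of "Suc n" m] pt_strict_antimono[of m "Suc m"] by auto
    have "slope 1 f (pt (Suc m)) = 0"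
      using p pt_bounds[of "Suc m"] by (intro slope_id_near[of "pt m - pt (Suc m)"]) (auto intro!: fix1)
    moreover have "slope (-1) f (pt m) = 0"
      using p pt_bounds[of m] by (intro slope_id_near[of "pt m"]) (auto intro!: fix1)
    ultimately show ?thesis using 3 by (simp add: val_def)
  qed
qed

section \<open>Conjugation inside a coded subgroup\<close>

lemma F_cancel:
  assumes "a \<in> thompson_F_set" "b \<in> thompson_F_set"
  shows "F_inv a \<odot> (a \<odot> b) = b" "a \<odot> (F_inv a \<odot> b) = b"
  using F.m_assoc[of "F_inv a" a b] F.m_assoc[of a "F_inv a" b] F_inv_closed[OF assms(1)] assms
  by simp_all

lemma F_conj_eq_iff:
  assumes "f \<in> thompson_F_set" "h \<in> thompson_F_set" "k \<in> thompson_F_set"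
    and eq: "F_inv k \<odot> f \<odot> k = F_inv h \<odot> f \<odot> h"
  shows "h \<odot> F_inv k \<odot> f = f \<odot> (h \<odot> F_inv k)"
proof -
  note c = assms(1-3) F_inv_closed[OF assms(2)] F_inv_closed[OF assms(3)] F_mult_closed
  have "h \<odot> (F_inv k \<odot> f \<odot> k) \<odot> F_inv k = h \<odot> F_inv k \<odot> f"
    using c by (simp add: F.m_assoc)
  moreover have "h \<odot> (F_inv h \<odot> f \<odot> h) \<odot> F_inv k = f \<odot> (h \<odot> F_inv k)"
    using c by (simp add: F.m_assoc F_cancel)
  ultimately show ?thesis using eq by simp
qed

lemma F_conj_commuting:
  assumes "f \<in> thompson_F_set" "k \<in> thompson_F_set" "c \<in> thompson_F_set"
    and "c \<odot> f = f \<odot> c" "c \<odot> k = k \<odot> c"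
  shows "F_inv (k \<odot> c) \<odot> f \<odot> (k \<odot> c) = F_inv k \<odot> f \<odot> k"
proof -
  note cl = assms(1-3) F_inv_closed[OF assms(2)] F_inv_closed[OF assms(3)] F_mult_closed
  have kc: "k \<odot> c = c \<odot> k" using assms(5) by simp
  have "F_inv (k \<odot> c) \<odot> f \<odot> (k \<odot> c) = F_inv k \<odot> (F_inv c \<odot> (f \<odot> (c \<odot> k)))"
    unfolding kc using cl by (simp add: F.m_assoc F.inv_mult_group)
  also have "f \<odot> (c \<odot> k) = c \<odot> (f \<odot> k)"
    using cl assms(4) F.m_assoc[of f c k] F.m_assoc[of c f k] by simp
  also have "F_inv c \<odot> (c \<odot> (f \<odot> k)) = f \<odot> k"
    using cl by (simp add: F_cancel)
  finally show ?thesis using cl by (simp add: F.m_assoc)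
qed

text \<open>A conjugator \<open>h\<close> with the same effect as \<open>k\<close> differs from
  \<open>k\<close> by an element of the centralizer of \<open>f\<close>, on which
  \<open>val (2 * n)\<close> vanishes. So \<open>val (2 * n) h = -1\<close> is forced, and this is
  allowed in the coded subgroup only if \<open>\<tau> n > 0\<close>. Conversely \<open>k\<close>
  violates only the relation between the two intervals, which is repaired in the second interval
  without disturbing \<open>f\<close> or \<open>k\<close>.\<close>

lemma coded_conjugate_iff:
  assumes f: "bump f (pt (Suc (2 * n))) (pt (2 * n)) (-1) 1" "contracts f (pt (Suc (2 * n))) (pt (2 * n))"
    and k: "bump k (pt (Suc (2 * n))) (pt (2 * n)) (-1) 0"
    and k': "bump k' (pt (Suc (2 * n + 1))) (pt (2 * n + 1)) (-1) 0"
  shows "conjugate_in (coded_subgroup \<tau>) f (F_inv k \<odot> f \<odot> k) \<longleftrightarrow> \<tau> n > 0"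
proof
  have F: "f \<in> thompson_F_set" "k \<in> thompson_F_set" "k' \<in> thompson_F_set"
    using f k k' by (auto simp: bump_def)
  have S: "f \<in> stab" "k \<in> stab" "k' \<in> stab"
    using bump_stab[OF f(1)] bump_stab[OF k] bump_stab[OF k'] by auto
  {
    assume "conjugate_in (coded_subgroup \<tau>) f (F_inv k \<odot> f \<odot> k)"
    then obtain h where h: "h \<in> coded_subgroup \<tau>" "F_inv k \<odot> f \<odot> k = F_inv h \<odot> f \<odot> h"
      unfolding conjugate_in_def by blast
    have hS: "h \<in> stab" using h(1) by (simp add: coded_subgroup_def)
    then have hF: "h \<in> thompson_F_set" by (simp add: stab_def)
    define u where "u = h \<odot> F_inv k"
    have u: "u \<in> stab" unfolding u_def by (intro stab_mult stab_inv hS S)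
    have "u \<odot> f = f \<odot> u" unfolding u_def by (rule F_conj_eq_iff[OF F(1) hF F(2) h(2)])
    then have "val (2 * n) u = 0"
      unfolding val_def using u by (intro bump_centralizer[OF f]) (auto simp: stab_def)
    then have "val (2 * n) h = val (2 * n) k"
      unfolding u_def using hS S by (simp add: val_mult val_inv stab_inv)
    also have "\<dots> = -1" using bump_val[OF k] by simp
    finally show "\<tau> n > 0" using h(1) by (cases "\<tau> n") (auto simp: coded_subgroup_def)
  }
  {
    assume \<tau>: "\<tau> n > 0"
    \<comment> \<open>\<open>k'\<close> has value \<open>-1\<close> on interval
      \<open>2 * n + 1\<close>, so this power has value \<open>- int (\<tau> n)\<close>, the
      multiple of \<open>val (2 * n) k = -1\<close> required by the relation.\<close>
    define c where "c = k' [^]\<^bsub>thompson_F\<^esub> \<tau> n"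
    have cF: "c \<in> thompson_F_set" unfolding c_def by (rule F_nat_pow_closed[OF F(3)])
    have cS: "c \<in> stab" unfolding c_def by (rule stab_nat_pow[OF S(3)])
    have "k' \<odot> f = f \<odot> k'" "k' \<odot> k = k \<odot> k'"
      using bump_commute[OF k' f(1)] bump_commute[OF k' k] by simp_all
    then have comm: "c \<odot> f = f \<odot> c" "c \<odot> k = k \<odot> c"
      unfolding c_def using F by (auto intro!: F.group_commutes_pow)
    have "val (2 * m) (k \<odot> c) = (if m = n then -1 else 0)" for m
      unfolding c_def using S bump_val[OF k, of "2 * m"] bump_val[OF k', of "2 * m"]
      by (simp add: val_mult val_nat_pow stab_nat_pow)
    moreover have "val (2 * m + 1) (k \<odot> c) = (if m = n then - int (\<tau> n) else 0)" for m
      unfolding c_def using S bump_val[OF k, of "2 * m + 1"] bump_val[OF k', of "2 * m + 1"]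
      by (simp add: val_mult val_nat_pow stab_nat_pow)
    ultimately have "k \<odot> c \<in> coded_subgroup \<tau>"
      using stab_mult[OF S(2) cS] \<tau> by (simp add: coded_subgroup_def)
    then show "conjugate_in (coded_subgroup \<tau>) f (F_inv k \<odot> f \<odot> k)"
      unfolding conjugate_in_def using F_conj_commuting[OF F(1,2) cF comm]
      by (intro bexI[of _ "k \<odot> c"]) simp_all
  }
qed

section \<open>Words\<close>

fun act :: "letter \<Rightarrow> real \<Rightarrow> real" where
  "act X0 t = (if t \<le> 1/2 then t / 2 else if t \<le> 3/4 then t - 1/4 else 2 * t - 1)"
| "act X0_inv t = (if t \<le> 1/4 then 2 * t else if t \<le> 1/2 then t + 1/4 else t / 2 + 1/2)"
| "act X1 t = (if t \<le> 1/2 then t else if t \<le> 3/4 then t / 2 + 1/4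
     else if t \<le> 7/8 then t - 1/8 else 2 * t - 1)"
| "act X1_inv t = (if t \<le> 1/2 then t else if t \<le> 5/8 then 2 * t - 1/2
     else if t \<le> 3/4 then t + 1/8 else t / 2 + 1/2)"

lemma letter_elem_closed: "letter_elem l \<in> thompson_F_set"
  by (cases l) (auto intro: F_gen_closed F_inv_closed)

lemma word_elem_closed: "word_elem w \<in> thompson_F_set"
  by (induction w) (auto intro: F_one_closed F_mult_closed letter_elem_closed)

lemma act_range: "t \<in> {0..1} \<Longrightarrow> act l t \<in> {0..1}"
  by (cases l) auto

lemma letter_elem_act:
  assumes "t \<in> {0..1}"
  shows "letter_elem l t = act l t"
proof (cases l)
  case X0_inv
  have "gen0 (act X0_inv t) = t" using assms by (auto simp: gen0_def field_simps)
  then show ?thesis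
    using F_inv_apply(1)[OF F_gen_closed(1) act_range[OF assms], of X0_inv] X0_inv by simp
next
  case X1_inv
  have "gen1 (act X1_inv t) = t" using assms by (auto simp: gen1_def field_simps)
  then show ?thesis
    using F_inv_apply(1)[OF F_gen_closed(2) act_range[OF assms], of X1_inv] X1_inv by simp
qed (use assms in \<open>auto simp: gen0_def gen1_def\<close>)

lemma word_elem_act: "t \<in> {0..1} \<Longrightarrow> word_elem w t = foldr act w t \<and> foldr act w t \<in> {0..1}"
proof (induction w)
  case (Cons l w)
  then show ?case
    using act_range[of "foldr act w t" l] letter_elem_act[of "foldr act w t" l]
    by (simp add: F_mult_apply letter_elem_closed word_elem_closed del: atLeastAtMost_iff)
qed (simp add: F_one_apply)

lemma word_elem_append: "word_elem (u @ v) = word_elem u \<odot> word_elem v"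
  by (induction u) (auto simp: F.m_assoc letter_elem_closed word_elem_closed)

text \<open>\<open>bump_word\<close> represents a copy of \<open>gen0\<close> rescaled to the fundamental domain \<open>[1/2, 3/4]\<close>
  of \<open>gen0\<close>; conjugating it by \<open>gen1\<close> shrinks the support to \<open>[1/2, 5/8]\<close>, which makes the
  slope at \<open>3/4\<close> trivial.\<close>

definition bump_word :: "letter list" where
  "bump_word = [X1, X1, X0_inv, X1_inv, X0, X1_inv]"

definition bump_word_inv :: "letter list" where
  "bump_word_inv = [X1, X0_inv, X1, X0, X1_inv, X1_inv]"

definition short_word :: "letter list" where
  "short_word = [X1] @ bump_word @ [X1_inv]"

definition short_word_inv :: "letter list" where
  "short_word_inv = [X1] @ bump_word_inv @ [X1_inv]"

text \<open>Put \<open>x2 = x0^-1 x1 x0\<close>, a copy of \<open>x1\<close> supported in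
  \<open>[3/4, 1]\<close>. The word spells \<open>x1^2 x2^-1 x1^-1\<close>, in which everything
  cancels on \<open>[3/4, 1]\<close>.\<close>

lemma bump_word_apply:
  assumes t: "0 \<le> t" "t \<le> 1"
  shows "word_elem bump_word t =
    (if t \<le> 1/2 then t else if t \<le> 5/8 then t / 2 + 1/4 else if t \<le> 11/16 then t - 1/16
     else if t \<le> 3/4 then 2 * t - 3/4 else t)"
proof -
  consider "t \<le> 1/2" | "1/2 < t" "t \<le> 5/8" | "5/8 < t" "t \<le> 11/16" | "11/16 < t" "t \<le> 3/4" | "3/4 < t"
    by linarith
  then have "foldr act bump_word t = (if t \<le> 1/2 then t else if t \<le> 5/8 then t / 2 + 1/4
     else if t \<le> 11/16 then t - 1/16 else if t \<le> 3/4 then 2 * t - 3/4 else t)"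
    by cases (use t in \<open>simp_all add: bump_word_def field_simps\<close>)
  then show ?thesis using word_elem_act[of t bump_word] t by simp
qed

lemma bump_bump_word: "bump (word_elem bump_word) (1/2) (3/4) (-1) 1"
proof -
  have "slope 1 (word_elem bump_word) (1/2) = -1"
    by (rule slope_eqI, rule germI[of "1/8"]) (auto simp: bump_word_apply power_int_def field_simps)
  moreover have "slope (-1) (word_elem bump_word) (3/4) = 1"
    by (rule slope_eqI, rule germI[of "1/16"]) (auto simp: bump_word_apply power_int_def field_simps)
  ultimately show ?thesis
    unfolding bump_def by (auto simp: word_elem_closed bump_word_apply)
qed

lemma contracts_bump_word: "contracts (word_elem bump_word) (1/2) (3/4)"
  unfolding contracts_def by (auto simp: bump_word_apply field_simps)

lemma word_elem_bump_word_inv: "word_elem bump_word_inv = F_inv (word_elem bump_word)"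
  by (simp add: bump_word_def bump_word_inv_def F.inv_mult_group F.m_assoc F_gen_closed
      F_mult_closed F_inv_closed)

lemma word_elem_short_word_inv: "word_elem short_word_inv = F_inv (word_elem short_word)"
  unfolding short_word_def short_word_inv_def word_elem_append word_elem_bump_word_inv
  by (simp add: F.inv_mult_group F.m_assoc F_gen_closed F_mult_closed F_inv_closed word_elem_closed)

lemma bump_short_word: "bump (word_elem short_word) (1/2) (3/4) (-1) 0"
proof (rule bump_weaken)
  have "word_elem short_word = gen1 \<odot> word_elem bump_word \<odot> F_inv gen1"
    unfolding short_word_def word_elem_append
    by (simp add: F.m_assoc F_gen_closed F_mult_closed F_inv_closed word_elem_closed)
  moreover have "gen1 (1/2) = 1/2" "gen1 (3/4) = 5/8" by (auto simp: gen1_def)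
  ultimately show "bump (word_elem short_word) (1/2) (5/8) (-1) 1"
    using bump_conj[OF bump_bump_word F_gen_closed(2)] by (simp only:)
qed auto

section \<open>Transport of the model bumps by powers of \<open>gen0\<close>\<close>

definition conj_word :: "nat \<Rightarrow> letter list \<Rightarrow> letter list" where
  "conj_word n w = replicate (Suc n) X0 @ w @ replicate (Suc n) X0_inv"

lemma word_elem_replicate:
  "word_elem (replicate n X0) = gen0 [^]\<^bsub>thompson_F\<^esub> n"
  "word_elem (replicate n X0_inv) = F_inv (gen0 [^]\<^bsub>thompson_F\<^esub> n)"
proof -
  have g: "gen0 \<in> carrier thompson_F" by (simp add: F_gen_closed)
  show "word_elem (replicate n X0) = gen0 [^]\<^bsub>thompson_F\<^esub> n"
    by (induction n) (use F.nat_pow_Suc2[OF g] in simp_all)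
  show "word_elem (replicate n X0_inv) = F_inv (gen0 [^]\<^bsub>thompson_F\<^esub> n)"
    by (induction n) (use F.inv_mult_group[OF _ g] F.nat_pow_closed[OF g] in simp_all)
qed

lemma word_elem_conj_word:
  "word_elem (conj_word n w) =
     gen0 [^]\<^bsub>thompson_F\<^esub> Suc n \<odot> word_elem w \<odot> F_inv (gen0 [^]\<^bsub>thompson_F\<^esub> Suc n)"
  unfolding conj_word_def word_elem_append word_elem_replicate
  by (rule F.m_assoc[symmetric])
    (simp_all only: carrier_F word_elem_closed F_nat_pow_closed F_gen_closed F_inv_closed)

text \<open>The first application of \<open>gen0\<close> takes \<open>3/4\<close> to
  \<open>1/2\<close>; on \<open>[0, 1/2]\<close> it halves. This fixes the exponent
  \<open>Suc n\<close> in \<open>conj_word\<close>.\<close>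

lemma gen0_pow_apply:
  "(gen0 [^]\<^bsub>thompson_F\<^esub> Suc n) (1/2) = pt (Suc n) \<and> (gen0 [^]\<^bsub>thompson_F\<^esub> Suc n) (3/4) = pt n"
proof (induction n)
  case 0
  have "gen0 [^]\<^bsub>thompson_F\<^esub> Suc 0 = gen0" using F.l_one[of gen0] by (simp add: F_gen_closed)
  then show ?case by (simp only:) (simp add: pt_def gen0_def power2_eq_square)
next
  case (Suc n)
  have g: "gen0 \<in> carrier thompson_F" by (simp add: F_gen_closed)
  have half: "gen0 (pt m) = pt (Suc m)" for m
    using pt_bounds[of m] pt_antimono[of 0 m] by (simp add: gen0_def pt_def)
  show ?case
    unfolding F.nat_pow_Suc2[OF g, of "Suc n"]
    using Suc F_mult_apply[OF F_gen_closed(1) F_nat_pow_closed[OF F_gen_closed(1), of "Suc n"]] half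
    by simp
qed

lemma bump_conj_word:
  "bump (word_elem w) (1/2) (3/4) k l \<Longrightarrow> bump (word_elem (conj_word n w)) (pt (Suc n)) (pt n) k l"
  using bump_conj[OF _ F_nat_pow_closed[OF F_gen_closed(1), of "Suc n"], of "word_elem w" "1/2" "3/4" k l]
  by (simp only: word_elem_conj_word gen0_pow_apply)

lemma contracts_conj_word:
  "contracts (word_elem w) (1/2) (3/4) \<Longrightarrow> contracts (word_elem (conj_word n w)) (pt (Suc n)) (pt n)"
  using contracts_conj[OF word_elem_closed _ _ _ _ F_nat_pow_closed[OF F_gen_closed(1), of "Suc n"],
      of "1/2" "3/4" w]
  by (simp only: word_elem_conj_word gen0_pow_apply)

lemma word_elem_conj_word_append:
  "word_elem (conj_word n (u @ v)) = word_elem (conj_word n u) \<odot> word_elem (conj_word n v)"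
proof -
  define c where "c = gen0 [^]\<^bsub>thompson_F\<^esub> Suc n"
  have c: "c \<in> thompson_F_set" unfolding c_def by (rule F_nat_pow_closed[OF F_gen_closed(1)])
  note cl = c F_inv_closed[OF c] word_elem_closed[of u] word_elem_closed[of v] F_mult_closed
  show ?thesis
    unfolding word_elem_conj_word c_def[symmetric] word_elem_append
    using cl by (simp add: F.m_assoc F_cancel)
qed

lemma word_elem_conj_word_short_inv:
  "word_elem (conj_word n short_word_inv) = F_inv (word_elem (conj_word n short_word))"
proof -
  define c where "c = gen0 [^]\<^bsub>thompson_F\<^esub> Suc n"
  have c: "c \<in> thompson_F_set" unfolding c_def by (rule F_nat_pow_closed[OF F_gen_closed(1)])
  note cl = c F_inv_closed[OF c] word_elem_closed[of short_word] F_inv_closed[OF word_elem_closed[of short_word]] F_mult_closed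
  show ?thesis
    unfolding word_elem_conj_word c_def[symmetric] word_elem_short_word_inv
    using cl by (simp add: F.m_assoc F.inv_mult_group)
qed

definition source_word :: "nat \<Rightarrow> letter list" where
  "source_word n = conj_word n bump_word"

definition target_word :: "nat \<Rightarrow> letter list" where
  "target_word n = conj_word n (short_word_inv @ bump_word @ short_word)"

lemma word_elem_target:
  "word_elem (target_word n) = F_inv (word_elem (conj_word n short_word)) \<odot> word_elem (source_word n) \<odot>
     word_elem (conj_word n short_word)"
  unfolding target_word_def source_word_def word_elem_conj_word_append word_elem_conj_word_short_inv
  by (simp add: F.m_assoc word_elem_closed F_inv_closed)

lemma source_word_conjugate_iff:
  "conjugate_in (coded_subgroup \<tau>) (word_elem (source_word (2 * n))) (word_elem (target_word (2 * n))) \<longleftrightarrow>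
     \<tau> n > 0"
  unfolding word_elem_target source_word_def
  by (rule coded_conjugate_iff[where k' = "word_elem (conj_word (2 * n + 1) short_word)"];
      intro bump_conj_word contracts_conj_word bump_bump_word bump_short_word contracts_bump_word)

text \<open>The end slopes \<open>-1\<close> and \<open>1\<close> cancel, so all values vanish and
  membership holds for every \<open>\<tau>\<close>. The inputs of the reduction thus always satisfy
  the promise of the conjugacy problem.\<close>

lemma source_word_mem: "word_elem (source_word n) \<in> coded_subgroup \<tau>"
proof -
  have b: "bump (word_elem (source_word n)) (pt (Suc n)) (pt n) (-1) 1"
    unfolding source_word_def by (intro bump_conj_word bump_bump_word)
  show ?thesis using bump_stab[OF b] bump_val[OF b] by (simp add: coded_subgroup_def)
qed

text \<open>Homomorphisms to the integers do not see conjugation by an element of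
  \<open>stab\<close>, so the values remain zero even though the conjugator itself may lie outside
  the subgroup.\<close>

lemma target_word_mem: "word_elem (target_word n) \<in> coded_subgroup \<tau>"
proof -
  have b: "bump (word_elem (source_word n)) (pt (Suc n)) (pt n) (-1) 1"
    unfolding source_word_def by (intro bump_conj_word bump_bump_word)
  have k: "bump (word_elem (conj_word n short_word)) (pt (Suc n)) (pt n) (-1) 0"
    by (intro bump_conj_word bump_short_word)
  show ?thesis
    using bump_stab[OF b] bump_val[OF b] bump_stab[OF k]
    by (simp add: coded_subgroup_def word_elem_target stab_mult stab_inv val_mult val_inv)
qed

section \<open>Evaluating words\<close>

definition side :: "bool \<Rightarrow> real" where
  "side s = (if s then 1 else - 1)"

text \<open>This settles ties at breakpoints: for a right slope the point belongs to the piece on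
  its right, for a left slope to the piece on its left.\<close>

definition below :: "bool \<Rightarrow> 'a::linorder \<Rightarrow> 'a \<Rightarrow> bool" where
  "below s x y \<longleftrightarrow> (if s then x < y else x \<le> y)"

fun letter_slope :: "bool \<Rightarrow> letter \<Rightarrow> real \<Rightarrow> int" where
  "letter_slope s X0 t = (if below s t (1/2) then -1 else if below s t (3/4) then 0 else 1)"
| "letter_slope s X0_inv t = (if below s t (1/4) then 1 else if below s t (1/2) then 0 else -1)"
| "letter_slope s X1 t = (if below s t (1/2) then 0 else if below s t (3/4) then -1
     else if below s t (7/8) then 0 else 1)"
| "letter_slope s X1_inv t = (if below s t (1/2) then 0 else if below s t (5/8) then 1
     else if below s t (3/4) then 0 else -1)"

lemma germ_piece:
  assumes "a < b" "\<And>t. a \<le> t \<Longrightarrow> t \<le> b \<Longrightarrow> f t = 2 powi k * t + c"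
    and "if s then a \<le> x \<and> x < b else a < x \<and> x \<le> b"
  shows "germ (side s) f x k"
proof (rule germI[of "if s then b - x else x - a"])
  fix h assume "0 \<le> h" "h \<le> (if s then b - x else x - a)"
  then show "f (x + side s * h) = f x + side s * (2 powi k * h)"
    using assms(3) assms(2)[of x] assms(2)[of "x + side s * h"]
    by (cases s) (auto simp: side_def algebra_simps)
qed (use assms(3) in auto)

lemma germ_act:
  assumes "0 < x" "x < 1"
  shows "germ (side s) (act l) x (letter_slope s l x)"
proof (cases l)
  case X0
  consider "below s x (1/2)" | "\<not> below s x (1/2)" "below s x (3/4)" | "\<not> below s x (3/4)"
    by blast
  then show ?thesis
  proof cases
    case 1
    then show ?thesis
      using X0 assms by (auto simp: below_def intro!: germ_piece[of "0" "1/2" _ _ "0"] split: if_splits)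
  next
    case 2
    then show ?thesis
      using X0 assms by (auto simp: below_def intro!: germ_piece[of "1/2" "3/4" _ _ "-1/4"] split: if_splits)
  next
    case 3
    then show ?thesis
      using X0 assms by (auto simp: below_def intro!: germ_piece[of "3/4" "1" _ _ "-1"] split: if_splits)
  qed
next
  case X0_inv
  consider "below s x (1/4)" | "\<not> below s x (1/4)" "below s x (1/2)" | "\<not> below s x (1/2)"
    by blast
  then show ?thesis
  proof cases
    case 1
    then show ?thesis
      using X0_inv assms by (auto simp: below_def intro!: germ_piece[of "0" "1/4" _ _ "0"] split: if_splits)
  next
    case 2
    then show ?thesis
      using X0_inv assms by (auto simp: below_def intro!: germ_piece[of "1/4" "1/2" _ _ "1/4"] split: if_splits)
  next
    case 3
    then show ?thesis
      using X0_inv assms by (auto simp: below_def intro!: germ_piece[of "1/2" "1" _ _ "1/2"] split: if_splits)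
  qed
next
  case X1
  consider "below s x (1/2)" | "\<not> below s x (1/2)" "below s x (3/4)" | "\<not> below s x (3/4)" "below s x (7/8)" | "\<not> below s x (7/8)"
    by blast
  then show ?thesis
  proof cases
    case 1
    then show ?thesis
      using X1 assms by (auto simp: below_def intro!: germ_piece[of "0" "1/2" _ _ "0"] split: if_splits)
  next
    case 2
    then show ?thesis
      using X1 assms by (auto simp: below_def intro!: germ_piece[of "1/2" "3/4" _ _ "1/4"] split: if_splits)
  next
    case 3
    then show ?thesis
      using X1 assms by (auto simp: below_def intro!: germ_piece[of "3/4" "7/8" _ _ "-1/8"] split: if_splits)
  next
    case 4
    then show ?thesis
      using X1 assms by (auto simp: below_def intro!: germ_piece[of "7/8" "1" _ _ "-1"] split: if_splits)
  qed
next
  case X1_inv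
  consider "below s x (1/2)" | "\<not> below s x (1/2)" "below s x (5/8)" | "\<not> below s x (5/8)" "below s x (3/4)" | "\<not> below s x (3/4)"
    by blast
  then show ?thesis
  proof cases
    case 1
    then show ?thesis
      using X1_inv assms by (auto simp: below_def intro!: germ_piece[of "0" "1/2" _ _ "0"] split: if_splits)
  next
    case 2
    then show ?thesis
      using X1_inv assms by (auto simp: below_def intro!: germ_piece[of "1/2" "5/8" _ _ "-1/2"] split: if_splits)
  next
    case 3
    then show ?thesis
      using X1_inv assms by (auto simp: below_def intro!: germ_piece[of "5/8" "3/4" _ _ "1/8"] split: if_splits)
  next
    case 4
    then show ?thesis
      using X1_inv assms by (auto simp: below_def intro!: germ_piece[of "3/4" "1" _ _ "1/2"] split: if_splits)
  qed
qed

lemma abs_side: "\<bar>side s\<bar> = 1"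
  by (simp add: side_def)

lemma slope_letter_elem:
  assumes "0 < x" "x < 1"
  shows "slope (side s) (letter_elem l) x = letter_slope s l x"
proof (rule slope_eqI[OF germ_cong[OF germ_act[OF assms] abs_side] abs_side])
  show "0 < min x (1 - x)" using assms by simp
  fix t assume "\<bar>t - x\<bar> \<le> min x (1 - x)"
  then have "t \<in> {0..1}" by auto
  then show "act l t = letter_elem l t" by (simp add: letter_elem_act)
qed

type_synonym state = "nat \<times> nat \<times> nat \<times> nat"

text \<open>The state \<open>(X, D, P, Q)\<close> stands for the point \<open>X / D\<close> and the slope \<open>2 ^ (P - Q)\<close> of the word
  read so far; multiplying the denominator by 8 in each step keeps the numerator integral.\<close>

definition step :: "bool \<Rightarrow> state \<Rightarrow> nat \<Rightarrow> state" where
  "step s st d = (let X = fst st; D = fst (snd st); P = fst (snd (snd st)); Q = snd (snd (snd st)) in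
     if d = 1 then
       (if below s (2 * X) D then (4 * X, 8 * D, P, Suc Q)
        else if below s (4 * X) (3 * D) then (8 * X - 2 * D, 8 * D, P, Q)
        else (16 * X - 8 * D, 8 * D, Suc P, Q))
     else if d = 2 then
       (if below s (4 * X) D then (16 * X, 8 * D, Suc P, Q)
        else if below s (2 * X) D then (8 * X + 2 * D, 8 * D, P, Q)
        else (4 * X + 4 * D, 8 * D, P, Suc Q))
     else if d = 3 then
       (if below s (2 * X) D then (8 * X, 8 * D, P, Q)
        else if below s (4 * X) (3 * D) then (4 * X + 2 * D, 8 * D, P, Suc Q)
        else if below s (8 * X) (7 * D) then (8 * X - D, 8 * D, P, Q)
        else (16 * X - 8 * D, 8 * D, Suc P, Q))
     else
       (if below s (2 * X) D then (8 * X, 8 * D, P, Q)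
        else if below s (8 * X) (5 * D) then (16 * X - 4 * D, 8 * D, Suc P, Q)
        else if below s (4 * X) (3 * D) then (8 * X + D, 8 * D, P, Q)
        else (4 * X + 4 * D, 8 * D, P, Suc Q)))"

definition state_pt :: "state \<Rightarrow> real" where
  "state_pt st = real (fst st) / real (fst (snd st))"

definition state_slope :: "state \<Rightarrow> int" where
  "state_slope st = int (fst (snd (snd st))) - int (snd (snd (snd st)))"

lemma below_frac:
  "0 < D \<Longrightarrow> 0 < a \<Longrightarrow> below s (real X / real D) (real b / real a) \<longleftrightarrow> below s (a * X) (b * D)"
proof -
  assume "0 < D" "0 < a"
  then have "below s (real X / real D) (real b / real a) \<longleftrightarrow> below s (real a * real X) (real b * real D)"
    by (auto simp: below_def field_simps)
  also have "\<dots> \<longleftrightarrow> below s (a * X) (b * D)"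
    unfolding below_def of_nat_mult[symmetric] of_nat_less_iff of_nat_le_iff ..
  finally show ?thesis .
qed

text \<open>In each branch the comparison bounds \<open>X / D\<close> from below, so the
  subtractions of natural numbers do not truncate. At a breakpoint the side may select another piece
  than \<open>act\<close> does, but both give the same value by continuity.\<close>

lemma step_correct:
  assumes "fst (snd st) > 0"
  shows "fst (snd (step s st (letter_digit l))) > 0"
    and "state_pt (step s st (letter_digit l)) = act l (state_pt st)"
    and "state_slope (step s st (letter_digit l)) = state_slope st + letter_slope s l (state_pt st)"
proof -
  obtain X D P Q where st: "st = (X, D, P, Q)" by (cases st) auto
  have D: "D > 0" using assms st by simp
  show "fst (snd (step s st (letter_digit l))) > 0"
    by (cases l) (use D in \<open>simp_all add: st step_def\<close>)
  note b = below_frac[OF D, of 2 s X 1] below_frac[OF D, of 4 s X 1] below_frac[OF D, of 4 s X 3]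
    below_frac[OF D, of 8 s X 5] below_frac[OF D, of 8 s X 7]
  show "state_slope (step s st (letter_digit l)) = state_slope st + letter_slope s l (state_pt st)"
    by (cases l) (use b in \<open>simp_all add: st step_def state_slope_def state_pt_def\<close>)
  show "state_pt (step s st (letter_digit l)) = act l (state_pt st)"
    by (cases l; cases s) (use D in \<open>auto simp: st step_def state_pt_def below_def field_simps of_nat_diff\<close>)
qed

text \<open>The start state is the point \<open>pt n\<close> with trivial slope. The digits are
  expected with the last letter of the word first, because the rightmost factor acts first.\<close>

definition eval_digits :: "bool \<Rightarrow> nat list \<Rightarrow> nat \<Rightarrow> state" where
  "eval_digits s ds n = foldl (step s) (1, 2 ^ Suc n, 0, 0) ds"

lemma eval_digits_correct:
  fixes w s n
  defines "st \<equiv> eval_digits s (rev (map letter_digit w)) n"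
  shows "fst (snd st) > 0" "state_pt st = word_elem w (pt n)"
    "state_slope st = slope (side s) (word_elem w) (pt n)"
proof -
  have "fst (snd st) > 0 \<and> state_pt st = word_elem w (pt n) \<and>
    state_slope st = slope (side s) (word_elem w) (pt n)"
    unfolding st_def
  proof (induction w)
    case Nil
    have "state_pt (1, 2 ^ Suc n, 0, 0) = pt n"
      by (simp add: state_pt_def pt_def power_one_over del: power_Suc)
    then show ?case
      using slope_one[OF pt_bounds(1,2) abs_side] F_one_apply[OF pt_bounds(3)]
      by (simp add: eval_digits_def state_slope_def del: power_Suc)
  next
    case (Cons l w)
    let ?st = "eval_digits s (rev (map letter_digit w)) n"
    have IH: "fst (snd ?st) > 0" "state_pt ?st = word_elem w (pt n)"
      "state_slope ?st = slope (side s) (word_elem w) (pt n)"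
      using Cons.IH by auto
    have e: "eval_digits s (rev (map letter_digit (l # w))) n = step s ?st (letter_digit l)"
      by (simp add: eval_digits_def)
    have i: "word_elem w (pt n) \<in> {0<..<1}"
      using thompson_F_interior[OF word_elem_closed] pt_bounds by simp
    have "slope (side s) (word_elem (l # w)) (pt n) =
        slope (side s) (word_elem w) (pt n) + letter_slope s l (word_elem w (pt n))"
      using slope_mult[OF letter_elem_closed word_elem_closed pt_bounds(1,2) abs_side]
        slope_letter_elem[of "word_elem w (pt n)" s l] i by simp
    moreover have "word_elem (l # w) (pt n) = act l (word_elem w (pt n))"
      using F_mult_apply[OF letter_elem_closed word_elem_closed pt_bounds(3)] i
      by (simp add: letter_elem_act)
    ultimately show ?case using step_correct[OF IH(1), of s l] IH e by simp
  qed
  then show "fst (snd st) > 0" "state_pt st = word_elem w (pt n)"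
    "state_slope st = slope (side s) (word_elem w) (pt n)" by auto
qed

text \<open>On \<open>[0, 1/4]\<close> each letter multiplies by \<open>1/2\<close>,
  \<open>1\<close> or \<open>2\<close>. The growth bound is carried along so that the value is still
  at most \<open>1/4\<close> when the next letter acts.\<close>

lemma word_elem_near_0:
  "\<exists>a::int. \<forall>t. 0 \<le> t \<and> t \<le> (1/2) ^ (length w + 2) \<longrightarrow>
     word_elem w t = 2 powi a * t \<and> word_elem w t \<le> 2 ^ length w * t"
proof (induction w)
  case Nil
  show ?case by (intro exI[of _ 0]) (auto simp: F_one_apply power2_eq_square)
next
  case (Cons l w)
  then obtain a :: int where a: "\<And>t. 0 \<le> t \<Longrightarrow> t \<le> (1/2) ^ (length w + 2) \<Longrightarrow>
      word_elem w t = 2 powi a * t \<and> word_elem w t \<le> 2 ^ length w * t" by blast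
  define b :: int where "b = (case l of X0 \<Rightarrow> -1 | X0_inv \<Rightarrow> 1 | _ \<Rightarrow> 0)"
  have act: "act l u = 2 powi b * u \<and> act l u \<le> 2 * u" if "0 \<le> u" "u \<le> 1/4" for u
    using that by (cases l) (auto simp: b_def)
  show ?case
  proof (intro exI[of _ "b + a"] allI impI)
    fix t :: real assume t: "0 \<le> t \<and> t \<le> (1/2) ^ (length (l # w) + 2)"
    have le: "(1/2::real) ^ (length (l # w) + 2) \<le> (1/2) ^ (length w + 2)"
      by (rule power_decreasing) auto
    have le1: "(1/2::real) ^ (length w + 2) \<le> 1" by (rule power_le_one) auto
    have tI: "t \<in> {0..1}" using t le le1 by auto
    have w: "word_elem w t = 2 powi a * t" "word_elem w t \<le> 2 ^ length w * t"
      using a[of t] t le by auto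
    have "2 ^ length w * t \<le> 2 ^ length w * (1/2) ^ (length (l # w) + 2)"
      using t by (intro mult_left_mono) auto
    also have "\<dots> = 1/8" by (simp add: power_one_over power_add)
    finally have u: "0 \<le> word_elem w t" "word_elem w t \<le> 1/4" using w t by auto
    have "word_elem (l # w) t = act l (word_elem w t)"
      using F_mult_apply[OF letter_elem_closed word_elem_closed tI] u by (simp add: letter_elem_act)
    then show "word_elem (l # w) t = 2 powi (b + a) * t \<and> word_elem (l # w) t \<le> 2 ^ length (l # w) * t"
      using act[OF u] w by (simp add: power_int_add)
  qed
qed

text \<open>A linear map that fixes one positive point has slope 1. The tested point is the right
  end of the region of guaranteed linearity.\<close>

lemma word_elem_id_near_0:
  assumes "word_elem w (pt (length w + 1)) = pt (length w + 1)" "0 \<le> t" "t \<le> pt (length w + 1)"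
  shows "word_elem w t = t"
proof -
  obtain a :: int where a: "\<And>t. 0 \<le> t \<Longrightarrow> t \<le> (1/2) ^ (length w + 2) \<Longrightarrow> word_elem w t = 2 powi a * t"
    using word_elem_near_0[of w] by blast
  have p: "pt (length w + 1) = (1/2) ^ (length w + 2)" by (simp add: pt_def)
  have "2 powi a * pt (length w + 1) = pt (length w + 1)"
    using a[of "pt (length w + 1)"] assms(1) p pt_bounds(1)[of "length w + 1"] by simp
  then have "(2::real) powi a = 1" using pt_bounds(1)[of "length w + 1"] by simp
  then show ?thesis using a[of t] assms p by simp
qed

lemma val_word_elem_eq_0:
  assumes "word_elem w (pt (length w + 1)) = pt (length w + 1)" "length w + 1 \<le> n"
  shows "val n (word_elem w) = 0"
proof -
  have p: "pt n \<le> pt (length w + 1)" "pt (Suc n) < pt n" "0 < pt (Suc n)"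
    using pt_antimono[OF assms(2)] pt_strict_antimono[of n "Suc n"] pt_bounds by auto
  have "slope 1 (word_elem w) (pt (Suc n)) = 0"
    using p by (intro slope_id_near[of "pt n - pt (Suc n)"]) (auto intro!: word_elem_id_near_0[OF assms(1)])
  moreover have "slope (-1) (word_elem w) (pt n) = 0"
    using p by (intro slope_id_near[of "pt n"]) (auto intro!: word_elem_id_near_0[OF assms(1)])
  ultimately show ?thesis by (simp add: val_def)
qed

text \<open>The bound includes the index \<open>length w + 1\<close>; fixing that point already
  makes the word act as the identity on all later ones.\<close>

lemma word_elem_stab_iff:
  "word_elem w \<in> stab \<longleftrightarrow> (\<forall>n<length w + 2. word_elem w (pt n) = pt n)"
proof
  assume *: "\<forall>n<length w + 2. word_elem w (pt n) = pt n"
  then have f: "word_elem w (pt (length w + 1)) = pt (length w + 1)" by simp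
  have "word_elem w (pt n) = pt n" for n
  proof (cases "n < length w + 2")
    case False
    then have "pt n \<le> pt (length w + 1)" by (intro pt_antimono) simp
    then show ?thesis using pt_bounds(1)[of n] by (intro word_elem_id_near_0[OF f]) auto
  qed (use * in simp)
  then show "word_elem w \<in> stab" by (simp add: stab_def word_elem_closed)
qed (simp add: stab_def)

section \<open>The decision problems\<close>

text \<open>The time is the code of the least derivation. It may be \<open>0\<close>, so the
  successor reserves \<open>0\<close> for machines that do not halt.\<close>

definition halting_index :: "nat \<Rightarrow> nat" where
  "halting_index n = (if \<exists>t. halts n t then Suc (LEAST t. halts n t) else 0)"

lemma halting_index_pos: "halting_index n > 0 \<longleftrightarrow> (\<exists>t. halts n t)"
  by (simp add: halting_index_def)

text \<open>A proposed positive value can be verified by a bounded search, although whether the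
  value is positive is undecidable. Membership tests rely only on such verifications.\<close>

lemma halting_index_eq_Suc: "halting_index n = Suc t \<longleftrightarrow> halts n t \<and> (\<forall>u<t. \<not> halts n u)"
proof -
  have "(LEAST t. halts n t) = t \<longleftrightarrow> halts n t \<and> (\<forall>u<t. \<not> halts n u)" if "halts n t'" for t'
  proof
    have "halts n (LEAST t. halts n t)" by (rule LeastI[of "halts n", OF that])
    moreover have "\<forall>u<(LEAST t. halts n t). \<not> halts n u" by (blast dest: not_less_Least)
    moreover assume "(LEAST t. halts n t) = t"
    ultimately show "halts n t \<and> (\<forall>u<t. \<not> halts n u)" by simp
  next
    assume *: "halts n t \<and> (\<forall>u<t. \<not> halts n u)"
    show "(LEAST t. halts n t) = t"
    proof (rule Least_equality)
      show "t \<le> y" if "halts n y" for y using * that by (cases "t \<le> y") auto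
    qed (use * in blast)
  qed
  note least = this
  show ?thesis
  proof (cases "\<exists>t. halts n t")
    case True
    then obtain t' where "halts n t'" ..
    from least[OF this] True show ?thesis by (simp add: halting_index_def)
  qed (simp add: halting_index_def)
qed

definition fixes_pt :: "nat list \<Rightarrow> nat \<Rightarrow> bool" where
  "fixes_pt ds n \<longleftrightarrow> fst (eval_digits True ds n) * 2 ^ Suc n = fst (snd (eval_digits True ds n))"

text \<open>Integer values are kept as differences of natural numbers, to which the computability
  rules apply.\<close>

definition val_pos :: "nat list \<Rightarrow> nat \<Rightarrow> nat" where
  "val_pos ds n = fst (snd (snd (eval_digits True ds (Suc n)))) + fst (snd (snd (eval_digits False ds n)))"

definition val_neg :: "nat list \<Rightarrow> nat \<Rightarrow> nat" where
  "val_neg ds n = snd (snd (snd (eval_digits True ds (Suc n)))) + snd (snd (snd (eval_digits False ds n)))"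

text \<open>The first alternative accepts when both values vanish, whatever the halting index is.
  Otherwise the index must be some \<open>Suc t\<close>; the sum of positive and negative parts
  bounds the absolute value of the odd entry and hence \<open>t\<close>. The last equation is the
  linear relation with its negative terms moved across.\<close>

definition relation_at :: "nat list \<Rightarrow> nat \<Rightarrow> bool" where
  "relation_at ds n \<longleftrightarrow>
     val_pos ds (2 * n) = val_neg ds (2 * n) \<and> val_pos ds (2 * n + 1) = val_neg ds (2 * n + 1) \<or>
     (\<exists>t<val_pos ds (2 * n + 1) + val_neg ds (2 * n + 1).
        (halts n t \<and> (\<forall>u<t. \<not> halts n u)) \<and>
        val_pos ds (2 * n + 1) + Suc t * val_neg ds (2 * n) = val_neg ds (2 * n + 1) + Suc t * val_pos ds (2 * n))"

definition member_digits :: "nat list \<Rightarrow> bool" where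
  "member_digits ds \<longleftrightarrow> (\<forall>n<length ds + 2. fixes_pt ds n) \<and> (\<forall>n<length ds + 2. relation_at ds n)"

lemma fixes_pt_correct: "fixes_pt (rev (map letter_digit w)) n \<longleftrightarrow> word_elem w (pt n) = pt n"
proof -
  define st where "st = eval_digits True (rev (map letter_digit w)) n"
  have D: "fst (snd st) > 0" and e: "state_pt st = word_elem w (pt n)"
    using eval_digits_correct[where s = True] by (auto simp: st_def)
  have "fixes_pt (rev (map letter_digit w)) n \<longleftrightarrow> real (fst st * 2 ^ Suc n) = real (fst (snd st))"
    unfolding fixes_pt_def st_def of_nat_eq_iff ..
  also have "\<dots> \<longleftrightarrow> state_pt st = pt n"
    using D by (auto simp: state_pt_def pt_def power_one_over field_simps simp del: power_Suc)
  finally show ?thesis by (simp add: e)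
qed

lemma val_correct:
  "val n (word_elem w) = int (val_pos (rev (map letter_digit w)) n) - int (val_neg (rev (map letter_digit w)) n)"
  using eval_digits_correct(3)[of True w "Suc n"] eval_digits_correct(3)[of False w n]
  by (simp add: val_def val_pos_def val_neg_def state_slope_def side_def)

lemma relation_at_correct:
  "relation_at (rev (map letter_digit w)) n \<longleftrightarrow>
     val (2 * n + 1) (word_elem w) = int (halting_index n) * val (2 * n) (word_elem w) \<and>
     (halting_index n = 0 \<longrightarrow> val (2 * n) (word_elem w) = 0)"
  (is "_ \<longleftrightarrow> ?b = _ * ?a \<and> _")
proof -
  let ?ds = "rev (map letter_digit w)"
  let ?p = "val_pos ?ds" and ?q = "val_neg ?ds"
  have a: "?a = int (?p (2 * n)) - int (?q (2 * n))" and b: "?b = int (?p (2 * n + 1)) - int (?q (2 * n + 1))"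
    by (rule val_correct)+
  have lin: "?p (2 * n + 1) + Suc t * ?q (2 * n) = ?q (2 * n + 1) + Suc t * ?p (2 * n) \<longleftrightarrow> ?b = int (Suc t) * ?a"
    for t
  proof -
    have "?p (2 * n + 1) + Suc t * ?q (2 * n) = ?q (2 * n + 1) + Suc t * ?p (2 * n) \<longleftrightarrow>
      int (?p (2 * n + 1) + Suc t * ?q (2 * n)) = int (?q (2 * n + 1) + Suc t * ?p (2 * n))"
      unfolding of_nat_eq_iff ..
    then show ?thesis unfolding a b by (simp add: algebra_simps)
  qed
  have rel: "relation_at ?ds n \<longleftrightarrow> ?a = 0 \<and> ?b = 0 \<or>
    (\<exists>t<?p (2 * n + 1) + ?q (2 * n + 1). halting_index n = Suc t \<and> ?b = int (Suc t) * ?a)"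
    unfolding relation_at_def halting_index_eq_Suc[symmetric] lin using a b by auto
  show ?thesis
  proof
    assume "relation_at ?ds n"
    then show "?b = int (halting_index n) * ?a \<and> (halting_index n = 0 \<longrightarrow> ?a = 0)"
      unfolding rel by auto
  next
    assume *: "?b = int (halting_index n) * ?a \<and> (halting_index n = 0 \<longrightarrow> ?a = 0)"
    show "relation_at ?ds n"
    proof (cases "?a = 0")
      case True
      then show ?thesis unfolding rel using * by simp
    next
      case False
      then obtain t where t: "halting_index n = Suc t" using * by (cases "halting_index n") auto
      have "int (Suc t) * 1 \<le> int (Suc t) * \<bar>?a\<bar>" using False by (intro mult_left_mono) auto
      also have "\<dots> = \<bar>?b\<bar>" using * t by (simp add: abs_mult)
      also have "\<dots> \<le> int (?p (2 * n + 1) + ?q (2 * n + 1))" unfolding b by simp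
      finally have "t < ?p (2 * n + 1) + ?q (2 * n + 1)" by simp
      then show ?thesis unfolding rel using * t by auto
    qed
  qed
qed

lemma member_digits_correct:
  "member_digits (rev (map letter_digit w)) \<longleftrightarrow> word_elem w \<in> coded_subgroup halting_index"
proof -
  have "(\<forall>n. relation_at (rev (map letter_digit w)) n) \<longleftrightarrow>
      (\<forall>n<length w + 2. relation_at (rev (map letter_digit w)) n)" if s: "word_elem w \<in> stab"
  proof -
    \<comment> \<open>Beyond the bound both intervals \<open>2 * n\<close> and
      \<open>2 * n + 1\<close> lie where the word is the identity, so the relation reads
      \<open>0 = 0\<close> for every halting index.\<close>
    have "relation_at (rev (map letter_digit w)) n" if "\<not> n < length w + 2" for n
      unfolding relation_at_correct
      using s that val_word_elem_eq_0[of w "2 * n"] val_word_elem_eq_0[of w "2 * n + 1"]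
      by (simp add: stab_def)
    then show ?thesis by blast
  qed
  moreover have "member_digits (rev (map letter_digit w)) \<longleftrightarrow>
      word_elem w \<in> stab \<and> (\<forall>n<length w + 2. relation_at (rev (map letter_digit w)) n)"
    by (simp add: member_digits_def fixes_pt_correct word_elem_stab_iff)
  moreover have "word_elem w \<in> coded_subgroup halting_index \<longleftrightarrow>
      word_elem w \<in> stab \<and> (\<forall>n. relation_at (rev (map letter_digit w)) n)"
    unfolding coded_subgroup_def relation_at_correct by simp
  ultimately show ?thesis by blast
qed

lemma computable_step:
  assumes "computable f" "computable g"
  shows "computable (\<lambda>x. step s (f x) (g x))"
proof -
  have "computable (\<lambda>p. step s (fst p) (snd p))"
    unfolding step_def Let_def below_def by (cases s; simp only: if_True if_False; intro computable_intros)
  from computable_comp2[OF this assms] show ?thesis .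
qed

lemma computable_eval_digits:
  assumes "computable f" "computable g"
  shows "computable (\<lambda>x. eval_digits s (f x) (g x))"
  unfolding eval_digits_def by (intro computable_intros computable_step assms)

lemma computable_member_digits: "computable member_digits"
proof -
  have fix_pt: "computable (\<lambda>x. fixes_pt (f x) (g x))" if "computable f" "computable g"
    for f :: "nat list \<times> nat \<Rightarrow> nat list" and g
    unfolding fixes_pt_def by (intro computable_intros computable_eval_digits that)
  have pos: "computable (\<lambda>p. val_pos (fst p) (snd p))" and neg: "computable (\<lambda>p. val_neg (fst p) (snd p))"
    unfolding val_pos_def val_neg_def by (intro computable_intros computable_eval_digits)+
  have "computable (\<lambda>p. relation_at (fst p) (snd p))"
    unfolding relation_at_def
    by (intro computable_intros computable_comp2[OF pos] computable_comp2[OF neg])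
  then have rel: "computable (\<lambda>p. relation_at (snd p) (fst p))"
    by (rule computable_comp2) (intro computable_intros)+
  have "computable (\<lambda>p. fixes_pt (snd p) (fst p))"
    unfolding fixes_pt_def by (intro computable_intros computable_eval_digits)
  then show ?thesis
    unfolding member_digits_def[abs_def]
    by (intro computable_conj computable_All_less rel computable_intros)
qed

text \<open>Digits range from 1 to 4, so the code of the tail is the largest \<open>q\<close> with
  \<open>4 * q\<close> strictly below the code; the inner recursion counts up to it. Consing the
  digits reverses the word, which is the order needed for evaluation.\<close>

definition decode_step :: "nat \<times> nat list \<Rightarrow> nat \<times> nat list" where
  "decode_step p = (if fst p = 0 then p
     else let q = rec_nat 0 (\<lambda>i y. if 4 * Suc y < fst p then Suc y else y) (fst p)
       in (q, (fst p - 4 * q) # snd p))"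

lemma decode_step_letter:
  "decode_step (letter_digit l + 4 * c, acc) = (c, letter_digit l # acc)"
proof -
  let ?n = "letter_digit l + 4 * c"
  have l: "0 < letter_digit l" "letter_digit l \<le> 4" by (cases l; simp)+
  have "rec_nat 0 (\<lambda>i y. if 4 * Suc y < ?n then Suc y else y) k = min k c" for k
  proof (induction k)
    case (Suc k)
    have "4 * Suc k < ?n \<longleftrightarrow> k < c" using l by auto
    moreover have "\<not> 4 * Suc c < ?n" using l by auto
    ultimately show ?case using Suc by (cases "k < c") (simp_all add: min_def)
  qed simp
  moreover have "min ?n c = c" by simp
  ultimately have "rec_nat 0 (\<lambda>i y. if 4 * Suc y < ?n then Suc y else y) ?n = c" by simp
  then show ?thesis using l by (simp add: decode_step_def)
qed

lemma decode_steps: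
  "length w \<le> k \<Longrightarrow> (decode_step ^^ k) (word_code w, acc) = (0, rev (map letter_digit w) @ acc)"
proof (induction w arbitrary: k acc)
  case Nil
  have "(decode_step ^^ k) (0, acc) = (0, acc)"
    by (induction k) (auto simp: decode_step_def)
  then show ?case by simp
next
  case (Cons l w)
  then obtain k' where "k = Suc k'" "length w \<le> k'" by (cases k) auto
  then show ?case using Cons.IH by (simp add: funpow_Suc_right decode_step_letter del: funpow.simps)
qed

lemma length_le_word_code: "length w \<le> word_code w"
proof (induction w)
  case (Cons l w)
  then show ?case by (cases l) auto
qed simp

text \<open>The code bounds the length of the word, and the state with code \<open>0\<close> is
  fixed, so iterating as often as the code says reads the whole word.\<close>

definition decode :: "nat \<Rightarrow> nat list" where
  "decode c = snd ((decode_step ^^ c) (c, []))"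

lemma decode_word_code: "decode (word_code w) = rev (map letter_digit w)"
  using decode_steps[OF length_le_word_code, of w "[]"] by (simp add: decode_def)

lemma computable_decode: "computable decode"
proof -
  have "computable (\<lambda>p. decode_step (fst p))"
    unfolding decode_step_def Let_def by (intro computable_intros)
  then show ?thesis
    unfolding decode_def[abs_def]
    by (intro computable_snd computable_funpow[where F = "\<lambda>y x. decode_step y"] computable_intros)
qed

lemma membership_decidable_coded: "membership_decidable (coded_subgroup halting_index)"
proof -
  have "computable (\<lambda>c. member_digits (decode c))"
    by (rule computable_comp[OF computable_member_digits computable_decode])
  then obtain r where r: "\<And>c. rec_eval r [c] (of_bool (member_digits (decode c)))"
    unfolding computable_def by (auto simp: enc_bool_def)
  have "rec_eval r [word_code w] (if word_elem w \<in> coded_subgroup halting_index then 1 else 0)" for w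
    using r[of "word_code w"] by (simp add: decode_word_code member_digits_correct of_bool_def)
  then show ?thesis unfolding membership_decidable_def by blast
qed

section \<open>Undecidability of conjugacy\<close>

lemma word_code_replicate:
  "word_code (replicate n l @ w) = ((\<lambda>c. letter_digit l + 4 * c) ^^ n) (word_code w)"
  by (induction n) auto

text \<open>Prefixing a letter acts on codes by an affine map. The two variable blocks are therefore
  iterations, and the fixed middle word is prefixed letter by letter.\<close>

lemma computable_conj_word: "computable f \<Longrightarrow> computable (\<lambda>x. word_code (conj_word (f x) w))"
proof -
  assume f: "computable f"
  have 1: "computable (\<lambda>x. ((\<lambda>c. letter_digit X0_inv + 4 * c) ^^ Suc (f x)) 0)"
    by (intro computable_funpow[where F = "\<lambda>c x. letter_digit X0_inv + 4 * c"] computable_intros f)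
  have 2: "computable (\<lambda>x. word_code (u @ replicate (Suc (f x)) X0_inv))" for u
  proof (induction u)
    case Nil
    show ?case using 1 word_code_replicate[of _ X0_inv "[]"] by simp
  next
    case (Cons l u)
    then show ?case by (simp only: append_Cons word_code.simps) (intro computable_intros)
  qed
  have "computable (\<lambda>x. ((\<lambda>c. letter_digit X0 + 4 * c) ^^ Suc (f x)) (word_code (w @ replicate (Suc (f x)) X0_inv)))"
    by (intro computable_funpow[where F = "\<lambda>c x. letter_digit X0 + 4 * c"] 2 computable_intros f)
  then show ?thesis unfolding conj_word_def word_code_replicate .
qed

text \<open>The source and target words form a computable reduction from halting, and composing it
  with a conjugacy procedure would decide halting.\<close>

lemma not_conjugacy_decidable_coded: "\<not> conjugacy_decidable (coded_subgroup halting_index)"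
proof
  assume "conjugacy_decidable (coded_subgroup halting_index)"
  then obtain r where r: "\<And>v w. word_elem v \<in> coded_subgroup halting_index \<Longrightarrow>
      word_elem w \<in> coded_subgroup halting_index \<Longrightarrow>
      rec_eval r [word_code v, word_code w]
        (if conjugate_in (coded_subgroup halting_index) (word_elem v) (word_elem w) then 1 else 0)"
    unfolding conjugacy_decidable_def by blast
  have "computable (\<lambda>n. word_code (source_word (2 * n)))" "computable (\<lambda>n. word_code (target_word (2 * n)))"
    unfolding source_word_def target_word_def by (intro computable_conj_word computable_intros)+
  then obtain r1 r2 where r1: "\<And>n. rec_eval r1 [n] (word_code (source_word (2 * n)))"
    and r2: "\<And>n. rec_eval r2 [n] (word_code (target_word (2 * n)))"
    unfolding computable_def by auto
  have "rec_eval (Comp r [r1, r2]) [n] (enc (\<exists>t. halts n t))" for n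
  proof (rule rec_eval_Comp2[OF r1 r2])
    show "rec_eval r [word_code (source_word (2 * n)), word_code (target_word (2 * n))] (enc (\<exists>t. halts n t))"
      using r[OF source_word_mem[of "2 * n"] target_word_mem[of "2 * n"]]
      by (simp add: source_word_conjugate_iff halting_index_pos enc_bool_def of_bool_def)
  qed
  then have "computable (\<lambda>n. \<exists>t. halts n t)"
    unfolding computable_def by (intro exI[of _ "Comp r [r1, r2]"]) simp
  then show False using halts_undecidable by contradiction
qed

theorem theorem1p1:
  shows "\<exists>H. subgroup H thompson_F \<and> \<not> conjugacy_decidable H \<and> membership_decidable H"
  using subgroup_coded not_conjugacy_decidable_coded membership_decidable_coded by blast

end
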